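(* Let $P$ be an irreducible, positive recurrent stochastic matrix on $\mathbb{F}=\mathbb{Z}_+\times\mathbb{D}$ which is block monotone with block size $d$ (i.e. $P\in\mathsf{BM}_d$). Suppose there exist a constant $b\in(0,\infty)$, a block-increasing column vector $v=(v(k,i))_{(k,i)\in\mathbb{F}}\in\mathsf{BI}_d$ with $v\ge e$, and a nondecreasing differentiable concave function $\phi:[1,\infty)\to(0,\infty)$ with $\lim_{t\to\infty}\phi'(t)=0$ such that $$Pv\le v-\phi\circ v+b\,1_0 .$$ Then, for all $n,m\in\mathbb{N}$, $$\|{}_{(n)}\pi_n-\pi\|\le \frac{8}{r_\phi(m-1)}\,v(1,\varpi)+2m\sum_{i\in\mathbb{D}}{}_{(n)}\pi_n(n,i),$$ $$\|{}_{(n)}\pi_n-\pi\|\le \frac{8}{r_\phi(m-1)}\,v(1,\varpi)+2mb\sum_{i\in\mathbb{D}}\frac{1}{\phi(v(n,i))}.$$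
   Context: Notation: $\mathbb{Z}_+=\{0,1,2,\dots\}$, $\mathbb{N}=\{1,2,\dots\}$, $d\in\mathbb{N}$, $\mathbb{D}=\{1,\dots,d\}$, $\mathbb{F}=\mathbb{Z}_+\times\mathbb{D}$. A stochastic matrix $P=(p(k,i;\ell,j))_{(k,i),(\ell,j)\in\mathbb{F}}$ has $d\times d$ blocks $P(k;\ell)=(p(k,i;\ell,j))_{i,j\in\mathbb{D}}$. All vector/matrix inequalities are entrywise; $e$ is the column vector of ones. Block monotonicity: $P\in\mathsf{BM}_d$ means $\sum_{m=\ell}^\infty P(k;m)\le\sum_{m=\ell}^\infty P(k+1;m)$ for all $k,\ell\in\mathbb{Z}_+$. In that case $\Psi:=\sum_{m=0}^\infty P(k;m)$ does not depend on $k$; when $P$ is irreducible, $\Psi$ is an irreducible $d\times d$ stochastic matrix, and $\varpi=(\varpi(i))_{i\in\mathbb{D}}$ denotes its unique stationary probability vector. A column vector $f=(f(k,i))_{(k,i)\in\mathbb{F}}$ is block increasing ($f\in\mathsf{BI}_d$) if $f(k,i)\le f(k+1,i)$ for all $(k,i)\in\mathbb{F}$. $\pi=(\pi(k,i))_{(k,i)\in\mathbb{F}}$ is the unique stationary probability vector of $P$. For $n\in\mathbb{N}$, the LC-block-augmented truncation ${}_{(n)}P_n$ of $P$ is the stochastic matrix on $\mathbb{F}$ with entries ${}_{(n)}p_n(k,i;\ell,j)=p(k,i;\ell,j)$ if $0\le\ell\le n-1$; $=\sum_{m=n}^\infty p(k,i;m,j)$ if $\ell=n$; $=0$ if $\ell>n$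 (for all $k\in\mathbb{Z}_+$, $i,j\in\mathbb{D}$). ${}_{(n)}\pi_n=({}_{(n)}\pi_n(k,i))_{(k,i)\in\mathbb{F}}$ denotes a stationary probability vector of ${}_{(n)}P_n$ (at least one exists). $\|\mu-\eta\|=\sum_{(k,i)\in\mathbb{F}}|\mu(k,i)-\eta(k,i)|$. For a function $\varphi$ on $\mathbb{F}$, $\varphi(k,\varpi)=\sum_{i\in\mathbb{D}}\varpi(i)\varphi(k,i)$. The vector $1_0$ has entries $1$ at $(0,i)$, $i\in\mathbb{D}$, and $0$ elsewhere; $\phi\circ v$ has entries $\phi(v(k,i))$. $H_\phi(x)=\int_1^x \frac{dy}{\phi(y)}$ for $x\ge1$; it is increasing with $H_\phi(x)\to\infty$, so it has an inverse $H_\phi^{-1}:[0,\infty)\to[1,\infty)$; $r_\phi(x)=\phi(H_\phi^{-1}(x))$ for $x\ge0$ and $r_\phi(x)=0$ for $x<0$. *)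

theory Defs
  imports "HOL-Analysis.Analysis"
begin

definition stochastic :: "('a \<Rightarrow> 'a \<Rightarrow> real) \<Rightarrow> bool" where
  "stochastic P \<longleftrightarrow> (\<forall>x y. 0 \<le> P x y) \<and> (\<forall>x. (P x has_sum 1) UNIV)"

primrec matrix_power :: "('a \<Rightarrow> 'a \<Rightarrow> real) \<Rightarrow> nat \<Rightarrow> 'a \<Rightarrow> 'a \<Rightarrow> real" where
  "matrix_power P 0 x y = (if x = y then 1 else 0)"
| "matrix_power P (Suc n) x y = (\<Sum>\<^sub>\<infinity>z. P x z * matrix_power P n z y)"

definition irreducible_matrix :: "('a \<Rightarrow> 'a \<Rightarrow> real) \<Rightarrow> bool" where
  "irreducible_matrix P \<longleftrightarrow> (\<forall>x y. \<exists>n. matrix_power P n x y > 0)"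

text \<open>\<open>first_passage P n x y\<close> is the probability that the chain started in \<open>x\<close> visits
  \<open>y\<close> at time \<open>n\<close> and at no time in \<open>{1..<n}\<close>.\<close>

primrec first_passage :: "('a \<Rightarrow> 'a \<Rightarrow> real) \<Rightarrow> nat \<Rightarrow> 'a \<Rightarrow> 'a \<Rightarrow> real" where
  "first_passage P 0 x y = 0"
| "first_passage P (Suc n) x y =
     (if n = 0 then P x y else (\<Sum>\<^sub>\<infinity>z\<in>-{y}. P x z * first_passage P n z y))"

definition positive_recurrent :: "('a \<Rightarrow> 'a \<Rightarrow> real) \<Rightarrow> bool" where
  "positive_recurrent P \<longleftrightarrow>
     (\<forall>x. (\<lambda>n. first_passage P n x x) sums 1 \<and>
          summable (\<lambda>n. real n * first_passage P n x x))"

definition stationary_prob :: "('a \<Rightarrow> 'a \<Rightarrow> real) \<Rightarrow> ('a \<Rightarrow> real) \<Rightarrow> bool" where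
  "stationary_prob P \<mu> \<longleftrightarrow>
     (\<forall>x. 0 \<le> \<mu> x) \<and> (\<mu> has_sum 1) UNIV \<and>
     (\<forall>y. ((\<lambda>x. \<mu> x * P x y) has_sum \<mu> y) UNIV)"

definition l1_dist :: "('a \<Rightarrow> real) \<Rightarrow> ('a \<Rightarrow> real) \<Rightarrow> real" where
  "l1_dist \<mu> \<eta> = (\<Sum>\<^sub>\<infinity>x. \<bar>\<mu> x - \<eta> x\<bar>)"

text \<open>A state is a pair of a level in \<open>nat\<close> and a phase in a finite type \<open>'d\<close>; the block
  size is \<open>d = CARD('d)\<close>.\<close>

definition block_monotone :: "(nat \<times> 'd \<Rightarrow> nat \<times> 'd \<Rightarrow> real) \<Rightarrow> bool" where
  "block_monotone P \<longleftrightarrow>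
     (\<forall>k l i j. (\<Sum>\<^sub>\<infinity>m\<in>{l..}. P (k, i) (m, j)) \<le> (\<Sum>\<^sub>\<infinity>m\<in>{l..}. P (Suc k, i) (m, j)))"

definition block_increasing :: "(nat \<times> 'd \<Rightarrow> real) \<Rightarrow> bool" where
  "block_increasing f \<longleftrightarrow> (\<forall>k i. f (k, i) \<le> f (Suc k, i))"

text \<open>The matrix \<open>\<Psi>\<close>. It is read off at level 0; for a block-monotone stochastic matrix every
  level \<open>k\<close> gives the same sum, since the matrices \<open>\<Sum>m. P(k;m)\<close> are entrywise nondecreasing
  in \<open>k\<close> and all have row sums 1.\<close>

definition phase_matrix :: "(nat \<times> 'd \<Rightarrow> nat \<times> 'd \<Rightarrow> real) \<Rightarrow> 'd \<Rightarrow> 'd \<Rightarrow> real" where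
  "phase_matrix P i j = (\<Sum>\<^sub>\<infinity>m. P (0, i) (m, j))"

definition phase_avg :: "(nat \<times> 'd::finite \<Rightarrow> real) \<Rightarrow> nat \<Rightarrow> ('d \<Rightarrow> real) \<Rightarrow> real" where
  "phase_avg f k w = (\<Sum>i\<in>UNIV. w i * f (k, i))"

definition lc_truncation ::
  "nat \<Rightarrow> (nat \<times> 'd \<Rightarrow> nat \<times> 'd \<Rightarrow> real) \<Rightarrow> nat \<times> 'd \<Rightarrow> nat \<times> 'd \<Rightarrow> real" where
  "lc_truncation n P x y =
     (if fst y < n then P x y
      else if fst y = n then (\<Sum>\<^sub>\<infinity>m\<in>{n..}. P x (m, snd y))
      else 0)"

text \<open>The drift condition \<open>P v \<le> v - \<phi> \<circ> v + b 1\<^sub>0\<close>. Summability of each row of \<open>P v\<close> is part of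
  the inequality: for \<open>v \<ge> 0\<close> a divergent row equals \<open>+\<infinity>\<close>, whereas \<open>infsum\<close> would be 0.\<close>

definition drift_condition ::
  "(nat \<times> 'd \<Rightarrow> nat \<times> 'd \<Rightarrow> real) \<Rightarrow> (nat \<times> 'd \<Rightarrow> real) \<Rightarrow> (real \<Rightarrow> real) \<Rightarrow> real \<Rightarrow> bool" where
  "drift_condition P v \<phi> b \<longleftrightarrow>
     (\<forall>x. (\<lambda>y. P x y * v y) summable_on UNIV \<and>
          (\<Sum>\<^sub>\<infinity>y. P x y * v y) \<le> v x - \<phi> (v x) + b * (if fst x = 0 then 1 else 0))"

definition H_fun :: "(real \<Rightarrow> real) \<Rightarrow> real \<Rightarrow> real" where
  "H_fun \<phi> x = integral {1..x} (\<lambda>y. 1 / \<phi> y)"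

definition r_fun :: "(real \<Rightarrow> real) \<Rightarrow> real \<Rightarrow> real" where
  "r_fun \<phi> x = (if x \<ge> 0 then \<phi> (inv_into {1..} (H_fun \<phi>) x) else 0)"

end

theory Submission
  imports Defs
begin

text \<open>
  Let \<open>\<delta>\<close> be the law that puts the phase distribution \<open>\<omega>\<close> on level 0, and let \<open>Q\<close> be the truncation.
  The triangle inequality through \<open>\<delta> Q\<^sup>m\<close> and \<open>\<delta> P\<^sup>m\<close> leaves three distances.
  The middle one grows per step by at most twice the mass that \<open>\<delta> Q\<^sup>k\<close> has on level \<open>n\<close>, and block
  monotonicity bounds that mass by the mass of the stationary law there.
  The outer two are instances of one estimate for a block-monotone chain with the drift condition:
  start one copy from \<open>\<delta>\<close> and a larger one from the stationary law \<open>\<pi>\<close>, both with the same phases; once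
  the larger copy visits level 0 they agree, so the distance after \<open>m\<close> steps is at most twice the
  probability that the larger copy has avoided level 0. By stationarity this probability is a tail sum,
  weighted by \<open>\<pi>\<close> on level 0, of the probabilities that an excursion from level 0 is still running.

  The tail sums are bounded with a backward Euler scheme. If \<open>T\<close> inverts \<open>t \<mapsto> t - \<phi> t\<close>, then \<open>T\<close> is
  concave, so Jensen turns \<open>P v \<le> v - \<phi> \<circ> v\<close> into \<open>P (T\<^sup>k\<^sup>+\<^sup>1 \<circ> v) \<le> T\<^sup>k \<circ> v\<close> off level 0, while
  \<open>T\<^sup>k 1\<close> runs ahead of the inverse of \<open>H_fun \<phi>\<close>, which brings in \<open>r_fun \<phi>\<close>.
\<close>

section \<open>Transport of summable functions by a stochastic matrix\<close>

lemma summable_on_abs: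
  fixes f :: "'a \<Rightarrow> real"
  assumes "f summable_on A" shows "(\<lambda>x. \<bar>f x\<bar>) summable_on A"
  using iffD1[OF summable_on_iff_abs_summable_on_real assms] unfolding real_norm_def .

lemma summable_on_absD:
  fixes f :: "'a \<Rightarrow> real"
  assumes "(\<lambda>x. \<bar>f x\<bar>) summable_on A" shows "f summable_on A"
  by (rule iffD2[OF summable_on_iff_abs_summable_on_real]) (use assms in \<open>unfold real_norm_def\<close>)

lemma infsum_diff:
  fixes f g :: "'a \<Rightarrow> real"
  assumes "f summable_on A" "g summable_on A"
  shows "(\<Sum>\<^sub>\<infinity>x\<in>A. f x - g x) = infsum f A - infsum g A"
  using infsum_add[of f A "\<lambda>x. - g x"] assms
  by (simp add: infsum_uminus summable_on_uminus)

lemma summable_on_diff: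
  fixes f g :: "'a \<Rightarrow> real"
  assumes "f summable_on A" "g summable_on A"
  shows "(\<lambda>x. f x - g x) summable_on A"
  using summable_on_add[of f A "\<lambda>x. - g x"] assms by (simp add: summable_on_uminus)

lemma has_sum_sum:
  fixes f :: "'b \<Rightarrow> 'a \<Rightarrow> real"
  assumes "finite I" and "\<And>i. i \<in> I \<Longrightarrow> (f i has_sum s i) A"
  shows "((\<lambda>x. \<Sum>i\<in>I. f i x) has_sum (\<Sum>i\<in>I. s i)) A"
  using assms by (induction I rule: finite_induct) (auto intro: has_sum_add)

lemma has_sum_diff:
  fixes f g :: "'a \<Rightarrow> real"
  assumes "(f has_sum a) A" "(g has_sum c) A"
  shows "((\<lambda>x. f x - g x) has_sum (a - c)) A"
  using has_sum_add[OF assms(1), of "\<lambda>x. - g x" "- c"] assms(2)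
  by (simp add: has_sum_uminus)

lemma summable_on_mult_bounded:
  fixes \<mu> f :: "'a \<Rightarrow> real"
  assumes \<mu>: "\<mu> summable_on A" and f: "\<And>x. \<bar>f x\<bar> \<le> C"
  shows "(\<lambda>x. \<mu> x * f x) summable_on A"
proof (rule summable_on_absD)
  show "(\<lambda>x. \<bar>\<mu> x * f x\<bar>) summable_on A"
  proof (rule summable_on_comparison_test)
    show "(\<lambda>x. \<bar>\<mu> x\<bar> * C) summable_on A"
      using \<mu> by (rule summable_on_cmult_left[OF summable_on_abs])
  qed (use f in \<open>auto simp: abs_mult intro: mult_left_mono\<close>)
qed

lemma abs_infsum_le:
  fixes f :: "'a \<Rightarrow> real"
  shows "\<bar>infsum f A\<bar> \<le> (\<Sum>\<^sub>\<infinity>x\<in>A. \<bar>f x\<bar>)"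
proof (cases "f summable_on A")
  case True
  from summable_on_abs[OF this] show ?thesis
    using norm_infsum_bound[of f A] by simp
qed (simp add: infsum_not_exists infsum_nonneg)

text \<open>The row vector \<open>\<mu>\<close> times \<open>P\<close>. No sign is imposed on
  \<open>\<mu>\<close>, because differences of two laws are transported as well.\<close>

definition push :: "('a \<Rightarrow> 'a \<Rightarrow> real) \<Rightarrow> ('a \<Rightarrow> real) \<Rightarrow> 'a \<Rightarrow> real" where
  "push P \<mu> y = (\<Sum>\<^sub>\<infinity>x. \<mu> x * P x y)"

lemma stochastic_nonneg: "stochastic P \<Longrightarrow> 0 \<le> P x y"
  and stochastic_has_sum: "stochastic P \<Longrightarrow> (P x has_sum 1) UNIV"
  and stochastic_summable: "stochastic P \<Longrightarrow> P x summable_on UNIV"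
  and stochastic_infsum: "stochastic P \<Longrightarrow> infsum (P x) UNIV = 1"
  unfolding stochastic_def by (auto intro: has_sum_imp_summable infsumI)

lemma stochastic_le_1:
  assumes "stochastic P" shows "P x y \<le> 1"
  using finite_sum_le_infsum[of "P x" UNIV "{y}"] assms
  by (simp add: stochastic_nonneg stochastic_summable stochastic_infsum)

lemma stochastic_average_bounded:
  assumes P: "stochastic P" and f: "\<And>y. \<bar>f y\<bar> \<le> C"
  shows "\<bar>\<Sum>\<^sub>\<infinity>y. P x y * f y\<bar> \<le> C"
proof -
  have "\<bar>\<Sum>\<^sub>\<infinity>y. P x y * f y\<bar> \<le> (\<Sum>\<^sub>\<infinity>y. \<bar>P x y * f y\<bar>)"
    by (rule abs_infsum_le)
  also have "\<dots> \<le> (\<Sum>\<^sub>\<infinity>y. P x y * C)"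
  proof (rule infsum_mono)
    show "(\<lambda>y. \<bar>P x y * f y\<bar>) summable_on UNIV"
      by (rule summable_on_abs[OF summable_on_mult_bounded[OF stochastic_summable[OF P] f]])
  qed (auto simp: abs_mult stochastic_nonneg[OF P] f
        intro!: mult_left_mono summable_on_cmult_left stochastic_summable[OF P])
  also have "\<dots> = C"
    by (simp add: infsum_cmult_left' stochastic_infsum[OF P])
  finally show ?thesis .
qed

text \<open>Without \<open>f\<close>, row \<open>x\<close> of the absolute values sums to
  \<open>\<bar>\<mu> x\<bar>\<close>, so the double family converges absolutely. This is the
  hypothesis of Fubini in \<open>push_duality\<close>.\<close>

lemma push_joint_summable:
  fixes f :: "'a \<Rightarrow> real"
  assumes P: "stochastic P" and \<mu>: "\<mu> summable_on UNIV" and f: "\<And>y. \<bar>f y\<bar> \<le> C"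
  shows "(\<lambda>(x, y). \<mu> x * P x y * f y) summable_on UNIV \<times> UNIV"
proof -
  have "(\<lambda>(x, y). \<bar>\<mu> x\<bar> * P x y) summable_on UNIV \<times> UNIV"
  proof (rule summable_on_SigmaI)
    show "((\<lambda>y. case (x, y) of (x, y) \<Rightarrow> \<bar>\<mu> x\<bar> * P x y) has_sum \<bar>\<mu> x\<bar>) UNIV" for x
      using has_sum_cmult_right[OF stochastic_has_sum[OF P], of "\<bar>\<mu> x\<bar>" x] by simp
  qed (use \<mu> in \<open>auto simp: stochastic_nonneg[OF P] summable_on_abs\<close>)
  then have "(\<lambda>z. \<bar>\<mu> (fst z)\<bar> * P (fst z) (snd z)) summable_on UNIV"
    by (simp add: case_prod_unfold)
  then have "(\<lambda>z. \<mu> (fst z) * P (fst z) (snd z)) summable_on UNIV"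
    by - (rule summable_on_absD, simp add: abs_mult stochastic_nonneg[OF P])
  from summable_on_mult_bounded[OF this, of "\<lambda>z. f (snd z)" C] f
  show ?thesis by (simp add: case_prod_unfold)
qed

lemma push_summable:
  assumes P: "stochastic P" and \<mu>: "\<mu> summable_on UNIV"
  shows "push P \<mu> summable_on UNIV"
proof -
  have "(\<lambda>(x, y). \<mu> x * P x y * 1) summable_on UNIV \<times> UNIV"
    by (rule push_joint_summable[OF P \<mu>, of _ 1]) auto
  then have "(\<lambda>(y, x). \<mu> x * P x y * 1) summable_on UNIV \<times> UNIV"
    using summable_on_swap[of "\<lambda>(x, y). \<mu> x * P x y * 1" UNIV UNIV]
    by (simp add: case_prod_unfold)
  from summable_on_Sigma_banach[OF this] show ?thesis
    unfolding push_def by simp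
qed

lemma push_duality:
  assumes P: "stochastic P" and \<mu>: "\<mu> summable_on UNIV" and f: "\<And>y. \<bar>f y\<bar> \<le> C"
  shows "(\<Sum>\<^sub>\<infinity>y. push P \<mu> y * f y) = (\<Sum>\<^sub>\<infinity>x. \<mu> x * (\<Sum>\<^sub>\<infinity>y. P x y * f y))"
proof -
  have "(\<Sum>\<^sub>\<infinity>x. \<mu> x * (\<Sum>\<^sub>\<infinity>y. P x y * f y)) = (\<Sum>\<^sub>\<infinity>x. \<Sum>\<^sub>\<infinity>y. \<mu> x * P x y * f y)"
    by (simp only: infsum_cmult_right' mult.assoc)
  also have "\<dots> = (\<Sum>\<^sub>\<infinity>y. \<Sum>\<^sub>\<infinity>x. \<mu> x * P x y * f y)"
    by (rule infsum_swap_banach[OF push_joint_summable[OF P \<mu> f]])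
  also have "\<dots> = (\<Sum>\<^sub>\<infinity>y. push P \<mu> y * f y)"
    by (simp add: infsum_cmult_left' push_def)
  finally show ?thesis ..
qed

lemma push_nonneg: "stochastic P \<Longrightarrow> (\<And>x. 0 \<le> \<mu> x) \<Longrightarrow> 0 \<le> push P \<mu> y"
  unfolding push_def by (auto intro!: infsum_nonneg simp: stochastic_nonneg)

lemma push_row_summable:
  assumes "stochastic P" "\<mu> summable_on UNIV"
  shows "(\<lambda>x. \<mu> x * P x y) summable_on UNIV"
  by (rule summable_on_mult_bounded[OF assms(2), of _ 1])
     (auto simp: stochastic_nonneg[OF assms(1)] stochastic_le_1[OF assms(1)])

lemma push_diff:
  assumes P: "stochastic P" and "\<mu> summable_on UNIV" "\<nu> summable_on UNIV"
  shows "push P (\<lambda>x. \<mu> x - \<nu> x) = (\<lambda>y. push P \<mu> y - push P \<nu> y)"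
  unfolding push_def left_diff_distrib
  using infsum_diff[OF push_row_summable[OF P assms(2)] push_row_summable[OF P assms(3)]]
  by simp

lemma push_funpow_summable:
  "stochastic P \<Longrightarrow> \<mu> summable_on UNIV \<Longrightarrow> (push P ^^ m) \<mu> summable_on UNIV"
  by (induction m) (auto intro: push_summable)

lemma push_funpow_nonneg:
  "stochastic P \<Longrightarrow> (\<And>x. 0 \<le> \<mu> x) \<Longrightarrow> 0 \<le> (push P ^^ m) \<mu> x"
  by (induction m arbitrary: x) (auto intro: push_nonneg)

lemma push_funpow_diff:
  assumes "stochastic P" and "\<mu> summable_on UNIV" "\<nu> summable_on UNIV"
  shows "(push P ^^ m) (\<lambda>x. \<mu> x - \<nu> x) = (\<lambda>y. (push P ^^ m) \<mu> y - (push P ^^ m) \<nu> y)"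
  by (induction m) (simp_all add: push_diff push_funpow_summable assms)

text \<open>Taking absolute values inside the sum can only increase it, and transport preserves
  total mass.\<close>

lemma push_l1_le:
  assumes P: "stochastic P" and \<mu>: "\<mu> summable_on UNIV"
  shows "(\<Sum>\<^sub>\<infinity>y. \<bar>push P \<mu> y\<bar>) \<le> (\<Sum>\<^sub>\<infinity>x. \<bar>\<mu> x\<bar>)"
proof -
  have a\<mu>: "(\<lambda>x. \<bar>\<mu> x\<bar>) summable_on UNIV"
    using \<mu> by (rule summable_on_abs)
  have "(\<Sum>\<^sub>\<infinity>y. \<bar>push P \<mu> y\<bar>) \<le> (\<Sum>\<^sub>\<infinity>y. push P (\<lambda>x. \<bar>\<mu> x\<bar>) y)"
  proof (rule infsum_mono)
    show "(\<lambda>y. \<bar>push P \<mu> y\<bar>) summable_on UNIV"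
      by (rule summable_on_abs[OF push_summable[OF P \<mu>]])
    show "push P (\<lambda>x. \<bar>\<mu> x\<bar>) summable_on UNIV"
      by (rule push_summable[OF P a\<mu>])
    show "\<bar>push P \<mu> y\<bar> \<le> push P (\<lambda>x. \<bar>\<mu> x\<bar>) y" for y
      unfolding push_def using abs_infsum_le[of "\<lambda>x. \<mu> x * P x y" UNIV]
      by (simp add: abs_mult stochastic_nonneg[OF P])
  qed
  also have "\<dots> = (\<Sum>\<^sub>\<infinity>x. \<bar>\<mu> x\<bar>)"
    using push_duality[OF P a\<mu>, of "\<lambda>_. 1" 1] by (simp add: stochastic_infsum[OF P])
  finally show ?thesis .
qed

section \<open>The block order\<close>

text \<open>Applied to laws and to rows \<open>P x\<close> alike. At \<open>l = 0\<close> it is the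
  phase marginal.\<close>

definition level_tail :: "(nat \<times> 'd \<Rightarrow> real) \<Rightarrow> nat \<Rightarrow> 'd \<Rightarrow> real" where
  "level_tail \<mu> l j = (\<Sum>\<^sub>\<infinity>m\<in>{l..}. \<mu> (m, j))"

text \<open>Stochastic order of the levels, phase by phase. The equality at level 0 says that the
  phase marginals agree, which is what later allows mass on level 0 to cancel.\<close>

definition block_le :: "(nat \<times> 'd \<Rightarrow> real) \<Rightarrow> (nat \<times> 'd \<Rightarrow> real) \<Rightarrow> bool" where
  "block_le \<rho> \<sigma> \<longleftrightarrow> (\<forall>l j. level_tail \<rho> l j \<le> level_tail \<sigma> l j) \<and>
     (\<forall>j. level_tail \<rho> 0 j = level_tail \<sigma> 0 j)"

lemma summable_on_levels:
  fixes g :: "nat \<times> 'd \<Rightarrow> real"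
  assumes "g summable_on UNIV" shows "(\<lambda>k. g (k, j)) summable_on A"
proof -
  have "g summable_on (\<lambda>k. (k, j)) ` A"
    using assms by (rule summable_on_subset_banach) simp
  then show ?thesis
    by (subst (asm) summable_on_reindex) (auto simp: inj_on_def o_def)
qed

lemma has_sum_levels:
  fixes g :: "nat \<times> 'd::finite \<Rightarrow> real"
  assumes "\<And>j. ((\<lambda>k. g (k, j)) has_sum s j) UNIV"
  shows "(g has_sum (\<Sum>j\<in>UNIV. s j)) UNIV"
proof -
  have "(g has_sum (\<Sum>j\<in>UNIV. s j)) (\<Union>j\<in>UNIV. (\<lambda>k. (k, j)) ` UNIV)"
  proof (rule sum_has_sum)
    show "(g has_sum s j) (range (\<lambda>k. (k, j)))" for j
      using assms by (subst has_sum_reindex) (auto simp: inj_on_def o_def)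
  qed auto
  moreover have "(\<Union>j\<in>UNIV. (\<lambda>k. (k, j)) ` UNIV) = (UNIV :: (nat \<times> 'd) set)"
    by auto
  ultimately show ?thesis by simp
qed

lemma infsum_levels:
  fixes g :: "nat \<times> 'd::finite \<Rightarrow> real"
  assumes "g summable_on UNIV"
  shows "infsum g UNIV = (\<Sum>j\<in>UNIV. \<Sum>\<^sub>\<infinity>k. g (k, j))"
  by (intro infsumI has_sum_levels has_sum_infsum summable_on_levels[OF assms])

text \<open>Writes a tail as the integral of a bounded indicator, the form to which
  \<open>push_duality\<close> applies.\<close>

lemma level_tail_eq_infsum:
  "level_tail \<mu> l j = (\<Sum>\<^sub>\<infinity>y. \<mu> y * of_bool (l \<le> fst y \<and> snd y = j))"
proof -
  have "level_tail \<mu> l j = infsum \<mu> ((\<lambda>k. (k, j)) ` {l..})"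
    unfolding level_tail_def by (subst infsum_reindex) (auto simp: inj_on_def o_def)
  also have "\<dots> = (\<Sum>\<^sub>\<infinity>y. \<mu> y * of_bool (l \<le> fst y \<and> snd y = j))"
    by (rule infsum_cong_neutral) (auto simp: image_iff)
  finally show ?thesis .
qed

lemma level_tail_Suc:
  fixes \<mu> :: "nat \<times> 'd \<Rightarrow> real"
  assumes "\<mu> summable_on UNIV"
  shows "level_tail \<mu> l j = \<mu> (l, j) + level_tail \<mu> (Suc l) j"
proof -
  have "{l..} = insert l {Suc l..}" by auto
  then show ?thesis
    unfolding level_tail_def
    by (simp add: infsum_insert summable_on_levels[OF assms])
qed

lemma level_tail_nonneg: "(\<And>x. 0 \<le> \<mu> x) \<Longrightarrow> 0 \<le> level_tail \<mu> l j"
  unfolding level_tail_def by (auto intro: infsum_nonneg)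

lemma infsum_phase_function:
  fixes \<mu> :: "nat \<times> 'd::finite \<Rightarrow> real"
  assumes "\<mu> summable_on UNIV"
  shows "(\<Sum>\<^sub>\<infinity>x. \<mu> x * g (snd x)) = (\<Sum>j\<in>UNIV. level_tail \<mu> 0 j * g j)"
proof (rule infsumI, rule has_sum_levels)
  fix j
  show "((\<lambda>k. \<mu> (k, j) * g (snd (k, j))) has_sum level_tail \<mu> 0 j * g j) UNIV"
    using has_sum_cmult_left[OF has_sum_infsum[OF summable_on_levels[OF assms, of j UNIV]], of "g j"]
    by (simp add: level_tail_def)
qed

lemma infsum_eq_level_tails:
  fixes \<mu> :: "nat \<times> 'd::finite \<Rightarrow> real"
  assumes "\<mu> summable_on UNIV"
  shows "infsum \<mu> UNIV = (\<Sum>j\<in>UNIV. level_tail \<mu> 0 j)"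
  using infsum_phase_function[OF assms, of "\<lambda>_. 1"] by simp

lemma block_increasing_mono:
  "block_increasing f \<Longrightarrow> k \<le> l \<Longrightarrow> f (k, i) \<le> f (l, i)"
  by (rule lift_Suc_mono_le[of "\<lambda>k. f (k, i)"]) (auto simp: block_increasing_def)

text \<open>Abel summation in each phase expresses the partial sums through \<open>f (0, j)\<close>,
  the increments of \<open>f\<close> and the tails, all with nonnegative coefficients. As
  \<open>f\<close> may be unbounded, summability against \<open>\<rho>\<close> is part of the
  conclusion.\<close>

lemma block_order_expectation:
  fixes \<rho> \<sigma> f :: "nat \<times> 'd::finite \<Rightarrow> real"
  assumes \<rho>: "\<And>x. 0 \<le> \<rho> x" "\<rho> summable_on UNIV"
    and \<sigma>: "\<And>x. 0 \<le> \<sigma> x" "\<sigma> summable_on UNIV"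
    and le: "\<And>l j. level_tail \<rho> l j \<le> level_tail \<sigma> l j"
    and f: "block_increasing f" "\<And>x. 0 \<le> f x"
    and sf: "(\<lambda>x. \<sigma> x * f x) summable_on UNIV"
  shows "(\<lambda>x. \<rho> x * f x) summable_on UNIV"
    and "(\<Sum>\<^sub>\<infinity>x. \<rho> x * f x) \<le> (\<Sum>\<^sub>\<infinity>x. \<sigma> x * f x)"
proof -
  have abel: "(\<Sum>k<N. \<mu> (k, j) * f (k, j)) + level_tail \<mu> N j * f (N, j) =
      f (0, j) * level_tail \<mu> 0 j + (\<Sum>l<N. (f (Suc l, j) - f (l, j)) * level_tail \<mu> (Suc l) j)"
    if "\<mu> summable_on UNIV" for \<mu> j N
  proof (induction N)
    case (Suc N)
    then show ?case
      using level_tail_Suc[OF that, of N j] by (simp add: algebra_simps)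
  qed (simp add: mult.commute)
  have bound: "(\<Sum>k<N. \<rho> (k, j) * f (k, j)) \<le> (\<Sum>\<^sub>\<infinity>k. \<sigma> (k, j) * f (k, j))" for j N
  proof -
    let ?s = "\<lambda>k. \<sigma> (k, j) * f (k, j)"
    have "(\<Sum>k<N. \<rho> (k, j) * f (k, j)) \<le>
        (\<Sum>k<N. \<rho> (k, j) * f (k, j)) + level_tail \<rho> N j * f (N, j)"
      using f(2) level_tail_nonneg[of \<rho>] \<rho>(1) by simp
    \<comment> \<open>The boundary term is absorbed by the rest of the series, since
      \<open>f (N, j) \<le> f (k, j)\<close> for \<open>k \<ge> N\<close>.\<close>
    also have "\<dots> \<le> (\<Sum>k<N. ?s k) + level_tail \<sigma> N j * f (N, j)"
      unfolding abel[OF \<rho>(2)] abel[OF \<sigma>(2)]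
      using f by (intro add_mono mult_left_mono sum_mono le) (auto simp: block_increasing_def)
    also have "\<dots> \<le> infsum ?s {..<N} + infsum ?s {N..}"
    proof -
      have "level_tail \<sigma> N j * f (N, j) = (\<Sum>\<^sub>\<infinity>k\<in>{N..}. \<sigma> (k, j) * f (N, j))"
        by (simp add: level_tail_def infsum_cmult_left')
      also have "\<dots> \<le> infsum ?s {N..}"
        using summable_on_levels[OF sf, of j "{N..}"] summable_on_levels[OF \<sigma>(2), of j "{N..}"]
        by (intro infsum_mono mult_left_mono summable_on_cmult_left)
           (auto intro: \<sigma>(1) block_increasing_mono[OF f(1)])
      finally show ?thesis by simp
    qed
    also have "\<dots> = infsum ?s ({..<N} \<union> {N..})"
      using summable_on_levels[OF sf, of j] by (intro infsum_Un_disjoint[symmetric]) auto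
    also have "{..<N} \<union> {N..} = UNIV" by auto
    finally show ?thesis .
  qed
  have nn: "0 \<le> \<rho> x * f x" for x using \<rho> f by simp
  have per: "summable (\<lambda>k. \<rho> (k, j) * f (k, j))" for j
    using bound[where j = j] nn by (intro summableI_nonneg_bounded) auto
  then have per': "(\<lambda>k. \<rho> (k, j) * f (k, j)) summable_on UNIV" for j
    using nn by (subst summable_on_UNIV_nonneg_real_iff) auto
  have le': "(\<Sum>\<^sub>\<infinity>k. \<rho> (k, j) * f (k, j)) \<le> (\<Sum>\<^sub>\<infinity>k. \<sigma> (k, j) * f (k, j))" for j
  proof -
    have "(\<lambda>k. \<rho> (k, j) * f (k, j)) sums (\<Sum>\<^sub>\<infinity>k. \<rho> (k, j) * f (k, j))"
      by (rule has_sum_imp_sums[OF has_sum_infsum[OF per']])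
    then show ?thesis
      unfolding sums_def by (rule LIMSEQ_le_const2) (use bound in auto)
  qed
  have hs: "((\<lambda>x. \<rho> x * f x) has_sum (\<Sum>j\<in>UNIV. \<Sum>\<^sub>\<infinity>k. \<rho> (k, j) * f (k, j))) UNIV"
    by (intro has_sum_levels has_sum_infsum per')
  show "(\<lambda>x. \<rho> x * f x) summable_on UNIV"
    using hs by (rule has_sum_imp_summable)
  show "(\<Sum>\<^sub>\<infinity>x. \<rho> x * f x) \<le> (\<Sum>\<^sub>\<infinity>x. \<sigma> x * f x)"
    unfolding infsumI[OF hs] infsum_levels[OF sf] by (intro sum_mono le')
qed

lemma level_tail_push:
  assumes "stochastic P" and "\<mu> summable_on UNIV"
  shows "level_tail (push P \<mu>) l j = (\<Sum>\<^sub>\<infinity>x. \<mu> x * level_tail (P x) l j)"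
  unfolding level_tail_eq_infsum by (rule push_duality[OF assms, of _ 1]) auto

lemma level_tail_row_le_1:
  assumes "stochastic P" shows "level_tail (P x) l j \<le> 1"
  using stochastic_average_bounded[OF assms, of "\<lambda>y. of_bool (l \<le> fst y \<and> snd y = j)" 1 x]
  unfolding level_tail_eq_infsum by auto

lemma block_monotone_level_tail:
  "block_monotone P \<longleftrightarrow> (\<forall>k l i j. level_tail (P (k, i)) l j \<le> level_tail (P (Suc k, i)) l j)"
  unfolding block_monotone_def level_tail_def ..

text \<open>The entries for level \<open>k\<close> dominate those for level 0, yet both families sum
  to 1 over the finitely many phases, so they coincide.\<close>

lemma block_monotone_phase_const:
  fixes P :: "nat \<times> 'd::finite \<Rightarrow> nat \<times> 'd \<Rightarrow> real"
  assumes P: "stochastic P" and bm: "block_monotone P"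
  shows "level_tail (P (k, i)) 0 j = phase_matrix P i j"
proof -
  have mono: "level_tail (P (0, i)) 0 j \<le> level_tail (P (k, i)) 0 j" for j
  proof (rule lift_Suc_mono_le[of "\<lambda>k. level_tail (P (k, i)) 0 j"])
    show "level_tail (P (k, i)) 0 j \<le> level_tail (P (Suc k, i)) 0 j" for k
      using bm by (simp add: block_monotone_level_tail)
  qed simp
  have "(\<Sum>j\<in>UNIV. level_tail (P (0, i)) 0 j) = (\<Sum>j\<in>UNIV. level_tail (P (k, i)) 0 j)"
    by (simp add: infsum_eq_level_tails[symmetric] stochastic_summable[OF P] stochastic_infsum[OF P])
  from sum_mono_inv[OF this mono]
  have "level_tail (P (0, i)) 0 j = level_tail (P (k, i)) 0 j" by simp
  then show ?thesis by (simp add: phase_matrix_def level_tail_def)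
qed

text \<open>Whatever the levels do, the phases evolve by themselves as a chain with matrix
  \<open>phase_matrix P\<close>.\<close>

lemma level_tail_push_0:
  fixes P :: "nat \<times> 'd::finite \<Rightarrow> nat \<times> 'd \<Rightarrow> real"
  assumes P: "stochastic P" and bm: "block_monotone P" and \<mu>: "\<mu> summable_on UNIV"
  shows "level_tail (push P \<mu>) 0 j = (\<Sum>i\<in>UNIV. level_tail \<mu> 0 i * phase_matrix P i j)"
proof -
  have "level_tail (P x) 0 j = phase_matrix P (snd x) j" for x
    using block_monotone_phase_const[OF P bm, of "fst x" "snd x" j] by simp
  then show ?thesis
    by (simp add: level_tail_push[OF P \<mu>] infsum_phase_function[OF \<mu>, of "\<lambda>i. phase_matrix P i j"])
qed

text \<open>A tail after one step is the integral of \<open>level_tail (P x) l j\<close>, which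
  block monotonicity makes block increasing in \<open>x\<close>. The tails at level 0 depend on the
  phase marginals alone.\<close>

lemma block_le_push:
  fixes P :: "nat \<times> 'd::finite \<Rightarrow> nat \<times> 'd \<Rightarrow> real"
  assumes P: "stochastic P" and bm: "block_monotone P"
    and \<rho>: "\<And>x. 0 \<le> \<rho> x" "\<rho> summable_on UNIV"
    and \<sigma>: "\<And>x. 0 \<le> \<sigma> x" "\<sigma> summable_on UNIV"
    and le: "block_le \<rho> \<sigma>"
  shows "block_le (push P \<rho>) (push P \<sigma>)"
  unfolding block_le_def
proof (intro conjI allI)
  fix l j
  have nn: "0 \<le> level_tail (P x) l j" for x
    by (rule level_tail_nonneg) (rule stochastic_nonneg[OF P])
  show "level_tail (push P \<rho>) l j \<le> level_tail (push P \<sigma>) l j"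
    unfolding level_tail_push[OF P \<rho>(2)] level_tail_push[OF P \<sigma>(2)]
  proof (rule block_order_expectation(2)[OF \<rho> \<sigma>])
    show "(\<lambda>x. \<sigma> x * level_tail (P x) l j) summable_on UNIV"
      by (rule summable_on_mult_bounded[OF \<sigma>(2), of _ 1])
         (simp add: nn level_tail_row_le_1[OF P])
  qed (use le bm nn in \<open>auto simp: block_le_def block_increasing_def block_monotone_level_tail\<close>)
next
  fix j
  show "level_tail (push P \<rho>) 0 j = level_tail (push P \<sigma>) 0 j"
    using le by (simp add: level_tail_push_0[OF P bm] \<rho> \<sigma> block_le_def)
qed

section \<open>Avoiding level 0\<close>

text \<open>The probability that the chain started in \<open>x\<close> is off level 0 at the times \<open>1, \<dots>, n\<close>; the
  starting point itself may lie on level 0.\<close>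

primrec survival :: "(nat \<times> 'd \<Rightarrow> nat \<times> 'd \<Rightarrow> real) \<Rightarrow> nat \<Rightarrow> nat \<times> 'd \<Rightarrow> real" where
  "survival P 0 x = 1"
| "survival P (Suc n) x = (\<Sum>\<^sub>\<infinity>y. P x y * (of_bool (0 < fst y) * survival P n y))"

lemma survival_bounds:
  assumes P: "stochastic P"
  shows "0 \<le> survival P n x" and "survival P n x \<le> 1"
proof -
  have "0 \<le> survival P n x \<and> survival P n x \<le> 1"
  proof (induction n arbitrary: x)
    case (Suc n)
    have "\<bar>\<Sum>\<^sub>\<infinity>y. P x y * (of_bool (0 < fst y) * survival P n y)\<bar> \<le> 1"
      using Suc by (intro stochastic_average_bounded[OF P]) (auto simp: of_bool_def)
    then have "survival P (Suc n) x \<le> 1" by simp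
    moreover have "0 \<le> survival P (Suc n) x"
      using Suc by (auto intro!: infsum_nonneg mult_nonneg_nonneg stochastic_nonneg[OF P])
    ultimately show ?case by blast
  qed simp
  then show "0 \<le> survival P n x" "survival P n x \<le> 1" by auto
qed

lemma survival_bounded_abs:
  assumes P: "stochastic P"
  shows "\<bar>of_bool b * survival P n y\<bar> \<le> 1"
  using survival_bounds[OF P, of n y] by (auto simp: of_bool_def)

text \<open>This replaces the pathwise coupling: the mass of \<open>\<sigma>\<close> on level 0 is matched by mass of \<open>\<rho>\<close> in
  the same phase, so it cancels from the difference without disturbing the order.\<close>

lemma block_le_remove_level_0:
  fixes \<rho> \<sigma> :: "nat \<times> 'd \<Rightarrow> real"
  assumes \<rho>: "\<And>x. 0 \<le> \<rho> x" "\<rho> summable_on UNIV"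
    and \<sigma>: "\<And>x. 0 \<le> \<sigma> x" "\<sigma> summable_on UNIV"
    and le: "block_le \<rho> \<sigma>"
  defines "\<rho>' \<equiv> \<lambda>x. \<rho> x - \<sigma> x * of_bool (fst x = 0)"
    and "\<sigma>' \<equiv> \<lambda>x. \<sigma> x * of_bool (0 < fst x)"
  shows "0 \<le> \<rho>' x" "\<rho>' summable_on UNIV" "0 \<le> \<sigma>' x" "\<sigma>' summable_on UNIV" "block_le \<rho>' \<sigma>'"
proof -
  have sm: "(\<lambda>x. \<sigma> x * of_bool (Q x)) summable_on UNIV" for Q
    by (rule summable_on_mult_bounded[OF \<sigma>(2), of _ 1]) auto
  \<comment> \<open>In phase \<open>j\<close> the totals agree and \<open>\<sigma>\<close> has the
    larger tail from level 1 on, hence the smaller mass on level 0.\<close>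
  have le0: "\<sigma> (0, j) \<le> \<rho> (0, j)" for j
    using level_tail_Suc[OF \<rho>(2), of 0 j] level_tail_Suc[OF \<sigma>(2), of 0 j] le
    unfolding block_le_def by (smt (verit))
  have s\<rho>: "\<rho>' summable_on UNIV"
    unfolding \<rho>'_def by (rule summable_on_diff[OF \<rho>(2) sm])
  have s\<sigma>: "\<sigma>' summable_on UNIV"
    unfolding \<sigma>'_def by (rule sm)
  have tail: "level_tail \<rho>' (Suc l) j = level_tail \<rho> (Suc l) j"
    "level_tail \<sigma>' (Suc l) j = level_tail \<sigma> (Suc l) j" for l j
    unfolding level_tail_def by (auto intro!: infsum_cong simp: \<rho>'_def \<sigma>'_def)
  have tail0: "level_tail \<rho>' 0 j = level_tail \<rho> 0 j - \<sigma> (0, j)"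
    "level_tail \<sigma>' 0 j = level_tail \<sigma> 0 j - \<sigma> (0, j)" for j
    using level_tail_Suc[OF \<rho>(2), of 0 j] level_tail_Suc[OF \<sigma>(2), of 0 j]
      level_tail_Suc[OF s\<rho>, of 0 j] level_tail_Suc[OF s\<sigma>, of 0 j] tail
    by (simp_all add: \<rho>'_def \<sigma>'_def)
  have "level_tail \<rho>' l j \<le> level_tail \<sigma>' l j" for l j
    using le by (cases l) (simp_all add: tail tail0 block_le_def)
  then show "block_le \<rho>' \<sigma>'"
    using le by (simp add: block_le_def tail0)
  show "0 \<le> \<rho>' x"
    using le0[of "snd x"] \<rho>(1)[of x] by (cases x) (auto simp: \<rho>'_def)
  show "\<rho>' summable_on UNIV" "\<sigma>' summable_on UNIV"
    by (fact s\<rho> s\<sigma>)+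
  show "0 \<le> \<sigma>' x"
    using \<sigma>(1)[of x] by (simp add: \<sigma>'_def)
qed

text \<open>Induction over all ordered pairs: cancel the common mass on level 0, transport the
  remainders, which are again ordered, and repeat. By duality, the part of \<open>\<sigma>\<close>
  off level 0 accumulates one more step of survival each time. The factor 2 counts two remainders of
  equal mass.\<close>

lemma push_difference_bound:
  fixes P :: "nat \<times> 'd::finite \<Rightarrow> nat \<times> 'd \<Rightarrow> real"
  assumes P: "stochastic P" and bm: "block_monotone P"
    and "\<And>x. 0 \<le> \<rho> x" "\<rho> summable_on UNIV" "\<And>x. 0 \<le> \<sigma> x" "\<sigma> summable_on UNIV" "block_le \<rho> \<sigma>"
  shows "(\<Sum>\<^sub>\<infinity>x. \<bar>(push P ^^ m) (\<lambda>x. \<rho> x - \<sigma> x) x\<bar>)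
      \<le> 2 * (\<Sum>\<^sub>\<infinity>x. \<sigma> x * (of_bool (0 < fst x) * survival P m x))"
  using assms(3-)
proof (induction m arbitrary: \<rho> \<sigma>)
  case 0
  define \<rho>' where "\<rho>' = (\<lambda>x. \<rho> x - \<sigma> x * of_bool (fst x = 0))"
  define \<sigma>' where "\<sigma>' = (\<lambda>x. \<sigma> x * of_bool (0 < fst x))"
  have r: "\<And>x. 0 \<le> \<rho>' x" "\<rho>' summable_on UNIV" "\<And>x. 0 \<le> \<sigma>' x" "\<sigma>' summable_on UNIV"
    "block_le \<rho>' \<sigma>'"
    unfolding \<rho>'_def \<sigma>'_def by (rule block_le_remove_level_0[OF 0])+
  have diff: "(\<lambda>x. \<rho> x - \<sigma> x) = (\<lambda>x. \<rho>' x - \<sigma>' x)"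
    by (rule ext) (simp add: \<rho>'_def \<sigma>'_def of_bool_def)
  have "(\<Sum>\<^sub>\<infinity>x. \<bar>\<rho>' x - \<sigma>' x\<bar>) \<le> (\<Sum>\<^sub>\<infinity>x. \<rho>' x + \<sigma>' x)"
  proof (rule infsum_mono)
    show "(\<lambda>x. \<bar>\<rho>' x - \<sigma>' x\<bar>) summable_on UNIV"
      by (rule summable_on_abs[OF summable_on_diff[OF r(2,4)]])
    show "(\<lambda>x. \<rho>' x + \<sigma>' x) summable_on UNIV"
      by (rule summable_on_add[OF r(2,4)])
    show "\<bar>\<rho>' x - \<sigma>' x\<bar> \<le> \<rho>' x + \<sigma>' x" for x
      using r(1,3)[of x] by auto
  qed
  also have "\<dots> = infsum \<rho>' UNIV + infsum \<sigma>' UNIV"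
    by (rule infsum_add[OF r(2,4)])
  also have "infsum \<rho>' UNIV = infsum \<sigma>' UNIV"
    using r(5) by (simp add: infsum_eq_level_tails r(2,4) block_le_def)
  finally show ?case by (simp add: diff) (simp add: \<sigma>'_def)
next
  case (Suc m)
  define \<rho>' where "\<rho>' = (\<lambda>x. \<rho> x - \<sigma> x * of_bool (fst x = 0))"
  define \<sigma>' where "\<sigma>' = (\<lambda>x. \<sigma> x * of_bool (0 < fst x))"
  have r: "\<And>x. 0 \<le> \<rho>' x" "\<rho>' summable_on UNIV" "\<And>x. 0 \<le> \<sigma>' x" "\<sigma>' summable_on UNIV"
    "block_le \<rho>' \<sigma>'"
    unfolding \<rho>'_def \<sigma>'_def by (rule block_le_remove_level_0[OF Suc.prems])+
  have diff: "(\<lambda>x. \<rho> x - \<sigma> x) = (\<lambda>x. \<rho>' x - \<sigma>' x)"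
    by (rule ext) (simp add: \<rho>'_def \<sigma>'_def of_bool_def)
  have eq: "(push P ^^ Suc m) (\<lambda>x. \<rho> x - \<sigma> x) = (push P ^^ m) (\<lambda>x. push P \<rho>' x - push P \<sigma>' x)"
    unfolding diff funpow_Suc_right o_def push_diff[OF P r(2,4)] ..
  have "(\<Sum>\<^sub>\<infinity>x. \<bar>(push P ^^ m) (\<lambda>x. push P \<rho>' x - push P \<sigma>' x) x\<bar>) \<le> 2 * (\<Sum>\<^sub>\<infinity>x. push P \<sigma>' x * (of_bool (0 < fst x) * survival P m x))"
    by (rule Suc.IH[OF push_nonneg[OF P r(1)] push_summable[OF P r(2)]
          push_nonneg[OF P r(3)] push_summable[OF P r(4)] block_le_push[OF P bm r]])
  also have "\<dots> = 2 * (\<Sum>\<^sub>\<infinity>x. \<sigma>' x * survival P (Suc m) x)"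
    using push_duality[OF P r(4), of "\<lambda>y. of_bool (0 < fst y) * survival P m y" 1]
    by (simp add: survival_bounded_abs[OF P])
  finally show ?case by (simp only: eq \<sigma>'_def mult.assoc)
qed

section \<open>The stationary mass that avoids level 0\<close>

lemma infsum_level:
  fixes g :: "nat \<times> 'd::finite \<Rightarrow> real"
  shows "(\<Sum>\<^sub>\<infinity>x. of_bool (fst x = n) * g x) = (\<Sum>i\<in>UNIV. g (n, i))"
proof -
  have "(\<Sum>\<^sub>\<infinity>x. of_bool (fst x = n) * g x) = infsum g (Pair n ` UNIV)"
    by (rule infsum_cong_neutral) (auto simp: image_iff)
  also have "\<dots> = (\<Sum>i\<in>UNIV. g (n, i))"
    by (simp add: sum.reindex inj_on_def)
  finally show ?thesis .
qed

lemma stationary_probD: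
  assumes "stationary_prob P \<mu>"
  shows "0 \<le> \<mu> x" "\<mu> summable_on UNIV" "infsum \<mu> UNIV = 1" "push P \<mu> = \<mu>" "(push P ^^ m) \<mu> = \<mu>"
proof -
  show "0 \<le> \<mu> x" "\<mu> summable_on UNIV" "infsum \<mu> UNIV = 1"
    using assms unfolding stationary_prob_def by (blast dest: has_sum_imp_summable infsumI)+
  show *: "push P \<mu> = \<mu>"
    using assms unfolding stationary_prob_def push_def fun_eq_iff by (blast dest: infsumI)
  show "(push P ^^ m) \<mu> = \<mu>" by (induction m) (simp_all add: *)
qed

text \<open>By stationarity the left side is the integral of \<open>survival P (Suc m)\<close>
  against \<open>\<pi>\<close>; the right side splits it by whether the start lies on level 0.
  Iteration turns the mass into a tail sum over excursions from level 0.\<close>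

lemma survival_mass_step:
  fixes P :: "nat \<times> 'd::finite \<Rightarrow> nat \<times> 'd \<Rightarrow> real"
  assumes P: "stochastic P" and \<pi>: "stationary_prob P \<pi>"
  shows "(\<Sum>\<^sub>\<infinity>x. \<pi> x * (of_bool (0 < fst x) * survival P m x)) =
    (\<Sum>i\<in>UNIV. \<pi> (0, i) * survival P (Suc m) (0, i)) +
    (\<Sum>\<^sub>\<infinity>x. \<pi> x * (of_bool (0 < fst x) * survival P (Suc m) x))"
proof -
  note \<pi>D = stationary_probD[OF \<pi>]
  have sm: "(\<lambda>x. \<pi> x * (of_bool (Q x) * survival P k x)) summable_on UNIV" for Q k
    by (rule summable_on_mult_bounded[OF \<pi>D(2), of _ 1]) (rule survival_bounded_abs[OF P])
  have "(\<Sum>\<^sub>\<infinity>x. \<pi> x * (of_bool (0 < fst x) * survival P m x)) = (\<Sum>\<^sub>\<infinity>x. \<pi> x * survival P (Suc m) x)"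
    using push_duality[OF P \<pi>D(2), of "\<lambda>y. of_bool (0 < fst y) * survival P m y" 1]
    by (simp add: survival_bounded_abs[OF P] \<pi>D(4))
  also have "\<dots> = (\<Sum>\<^sub>\<infinity>x. \<pi> x * (of_bool (fst x = 0) * survival P (Suc m) x) +
      \<pi> x * (of_bool (0 < fst x) * survival P (Suc m) x))"
    by (rule infsum_cong) (auto simp: of_bool_def)
  also have "\<dots> = (\<Sum>\<^sub>\<infinity>x. \<pi> x * (of_bool (fst x = 0) * survival P (Suc m) x)) +
      (\<Sum>\<^sub>\<infinity>x. \<pi> x * (of_bool (0 < fst x) * survival P (Suc m) x))"
    by (rule infsum_add[OF sm sm])
  also have "(\<Sum>\<^sub>\<infinity>x. \<pi> x * (of_bool (fst x = 0) * survival P (Suc m) x)) =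
      (\<Sum>\<^sub>\<infinity>x. of_bool (fst x = 0) * (\<pi> x * survival P (Suc m) x))"
    by (rule infsum_cong) simp
  also have "\<dots> = (\<Sum>i\<in>UNIV. \<pi> (0, i) * survival P (Suc m) (0, i))"
    by (rule infsum_level)
  finally show ?thesis .
qed

text \<open>Dominated convergence: a finite set carries all but \<open>e / 2\<close> of the mass,
  and on it the convergence is a finite sum of limits.\<close>

lemma infsum_dominated_tendsto_0:
  fixes \<mu> :: "'a \<Rightarrow> real" and g :: "nat \<Rightarrow> 'a \<Rightarrow> real"
  assumes \<mu>: "\<And>x. 0 \<le> \<mu> x" "\<mu> summable_on UNIV"
    and g: "\<And>n x. 0 \<le> g n x" "\<And>n x. g n x \<le> 1" and lim: "\<And>x. (\<lambda>n. g n x) \<longlonglongrightarrow> 0"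
  shows "(\<lambda>n. \<Sum>\<^sub>\<infinity>x. \<mu> x * g n x) \<longlonglongrightarrow> 0"
proof (rule LIMSEQ_I)
  fix e :: real assume e: "e > 0"
  obtain F where F: "finite F" "F \<subseteq> UNIV" "dist (sum \<mu> F) (infsum \<mu> UNIV) \<le> e / 2"
    using infsum_finite_approximation[OF \<mu>(2), of "e / 2"] e by auto
  have "(\<lambda>n. \<Sum>x\<in>F. \<mu> x * g n x) \<longlonglongrightarrow> (\<Sum>x\<in>F. \<mu> x * 0)"
    by (intro tendsto_intros lim)
  then have "\<forall>\<^sub>F n in sequentially. \<bar>\<Sum>x\<in>F. \<mu> x * g n x\<bar> < e / 2"
    using tendstoD[where e = "e / 2"] e by (fastforce simp: dist_real_def)
  then obtain N where N: "\<And>n. n \<ge> N \<Longrightarrow> \<bar>\<Sum>x\<in>F. \<mu> x * g n x\<bar> < e / 2"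
    by (auto simp: eventually_sequentially)
  have sm: "(\<lambda>x. \<mu> x * g n x) summable_on A" for n A
    by (rule summable_on_subset_banach[OF summable_on_mult_bounded[OF \<mu>(2), of _ 1]])
       (use g in auto)
  have s\<mu>: "\<mu> summable_on A" for A
    by (rule summable_on_subset_banach[OF \<mu>(2)]) simp
  have "norm ((\<Sum>\<^sub>\<infinity>x. \<mu> x * g n x) - 0) < e" if "n \<ge> N" for n
  proof -
    have "(\<Sum>\<^sub>\<infinity>x. \<mu> x * g n x) = infsum (\<lambda>x. \<mu> x * g n x) (F \<union> - F)" by simp
    also have "\<dots> = (\<Sum>x\<in>F. \<mu> x * g n x) + (\<Sum>\<^sub>\<infinity>x\<in>-F. \<mu> x * g n x)"
      using F by (subst infsum_Un_disjoint) (auto simp: sm)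
    also have "(\<Sum>\<^sub>\<infinity>x\<in>-F. \<mu> x * g n x) \<le> infsum \<mu> (-F)"
      using \<mu>(1) g by (intro infsum_mono sm s\<mu>) (simp add: mult_left_le)
    also have "infsum \<mu> (-F) = infsum \<mu> (F \<union> - F) - sum \<mu> F"
      using F by (subst infsum_Un_disjoint) (auto simp: s\<mu>)
    also have "\<dots> = - (sum \<mu> F - infsum \<mu> UNIV)" by simp
    also have "\<dots> \<le> e / 2" using F(3) unfolding dist_real_def by (rule abs_le_D2)
    finally have "(\<Sum>\<^sub>\<infinity>x. \<mu> x * g n x) < e" using N[OF that] by simp
    moreover have "0 \<le> (\<Sum>\<^sub>\<infinity>x. \<mu> x * g n x)" using \<mu> g by (intro infsum_nonneg) auto
    ultimately show ?thesis by simp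
  qed
  then show "\<exists>N. \<forall>n\<ge>N. norm ((\<Sum>\<^sub>\<infinity>x. \<mu> x * g n x) - 0) < e" by blast
qed

section \<open>The backward Euler scheme\<close>

locale concave_rate =
  fixes \<phi> :: "real \<Rightarrow> real"
  assumes pos: "t \<ge> 1 \<Longrightarrow> \<phi> t > 0"
    and mono: "mono_on {1..} \<phi>"
    and diff: "\<phi> differentiable_on {1..}"
    and conc: "concave_on {1..} \<phi>"
    and slope: "(deriv \<phi> \<longlongrightarrow> 0) at_top"
begin

lemma cont: "continuous_on {1..} \<phi>"
  using diff by (rule differentiable_imp_continuous_on)

lemma concD:
  assumes "a \<ge> 1" "c \<ge> 1" "0 \<le> u" "u \<le> 1"
  shows "(1 - u) * \<phi> a + u * \<phi> c \<le> \<phi> ((1 - u) * a + u * c)"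
  using concave_onD[OF conc assms(3,4), of a c] assms by simp

text \<open>The vanishing slope makes \<open>t - \<phi> t\<close> unbounded above, so that
  \<open>T\<close> can be defined arbitrarily far out.\<close>

lemma drift_exceeds: "\<exists>t>1. t - \<phi> t \<ge> s"
proof -
  have "\<forall>\<^sub>F t in at_top. \<bar>deriv \<phi> t\<bar> < 1 / 2"
    using tendstoD[OF slope, of "1 / 2"] by (simp add: dist_real_def)
  then obtain t0 where t0: "\<And>t. t \<ge> t0 \<Longrightarrow> \<bar>deriv \<phi> t\<bar> < 1 / 2"
    by (auto simp: eventually_at_top_linorder)
  \<comment> \<open>From \<open>a\<close> on the slope is below 1/2, and \<open>a \<ge> 2\<close>
    keeps to the interior, where \<open>deriv\<close> is the derivative. Thus
    \<open>t - \<phi> t \<ge> t / 2 - \<phi> a\<close>, and \<open>t\<close> is chosen to lift this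
    to \<open>s\<close>.\<close>
  define a where "a = max 2 t0"
  define t where "t = max (a + 1) (2 * (s + \<phi> a))"
  have at: "a < t" by (simp add: t_def)
  have der: "(\<phi> has_real_derivative deriv \<phi> x) (at x)" if "x > 1" for x
  proof -
    have "\<phi> differentiable at x within {1..}"
      using diff that by (auto simp: differentiable_on_def)
    then have "\<phi> differentiable at x"
      using that at_within_interior[of x "{1..}"] by simp
    then show ?thesis
      by (simp add: DERIV_deriv_iff_real_differentiable)
  qed
  obtain z where z: "a < z" "z < t" "\<phi> t - \<phi> a = (t - a) * deriv \<phi> z"
    using MVT2[OF at, of \<phi> "deriv \<phi>"] der by (auto simp: a_def)
  have "(t - a) * deriv \<phi> z \<le> (t - a) * (1 / 2)"
    using t0[of z] z at by (intro mult_left_mono) (auto simp: a_def)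
  moreover have "0 < a" by (simp add: a_def)
  ultimately have "\<phi> t \<le> \<phi> a + t / 2" using z(3) by (simp add: field_simps)
  moreover have "t \<ge> 2 * (s + \<phi> a)" by (simp add: t_def)
  ultimately have "t - \<phi> t \<ge> s" by simp
  moreover have "t > 1" using at by (simp add: a_def)
  ultimately show ?thesis by blast
qed

text \<open>The function \<open>t - \<phi> t\<close> is convex and may decrease at first; once it
  exceeds its value at 1, it increases strictly. The proof writes \<open>t\<close> as a convex
  combination of 1 and \<open>t'\<close>.\<close>

lemma drift_strict_mono:
  assumes "1 \<le> t" "t < t'" "1 - \<phi> 1 < t - \<phi> t"
  shows "t - \<phi> t < t' - \<phi> t'"
proof -
  define u where "u = (t - 1) / (t' - 1)"
  have u: "0 \<le> u" "u < 1" using assms by (auto simp: u_def)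
  have teq: "(1 - u) * 1 + u * t' = t"
  proof -
    have "u * (t' - 1) = t - 1" using assms by (simp add: u_def)
    then show ?thesis by (simp add: algebra_simps)
  qed
  have "(1 - u) * \<phi> 1 + u * \<phi> t' \<le> \<phi> t"
    using concD[of 1 t' u] u assms teq by simp
  then have le: "t - \<phi> t \<le> (1 - u) * (1 - \<phi> 1) + u * (t' - \<phi> t')"
    using teq by (simp add: algebra_simps)
  have "(1 - u) * (1 - \<phi> 1) < (1 - u) * (t - \<phi> t)"
    using u assms by (intro mult_strict_left_mono) auto
  with le have "u * (t - \<phi> t) < u * (t' - \<phi> t')"
    by (simp add: algebra_simps)
  then show ?thesis using u by (simp add: mult_less_cancel_left)
qed

text \<open>Meaningful for \<open>s > 1 - \<phi> 1\<close> only. This open half-line contains \<open>1\<close> in its interior, so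
  that tangents to \<open>T\<close> exist at every point that matters.\<close>

definition T :: "real \<Rightarrow> real" where
  "T s = (THE t. t > 1 \<and> t - \<phi> t = s)"

lemma T_ex1:
  assumes "s > 1 - \<phi> 1" shows "\<exists>!t. t > 1 \<and> t - \<phi> t = s"
proof -
  obtain t1 where t1: "t1 > 1" "t1 - \<phi> t1 \<ge> s" using drift_exceeds by blast
  have "continuous_on {1..t1} (\<lambda>t. t - \<phi> t)"
    by (intro continuous_intros continuous_on_subset[OF cont]) auto
  then obtain t where t: "1 \<le> t" "t \<le> t1" "t - \<phi> t = s"
    using IVT'[of "\<lambda>t. t - \<phi> t" 1 s t1] t1 assms by auto
  have "t \<noteq> 1" using t assms by auto
  with t have t': "t > 1 \<and> t - \<phi> t = s" by auto
  moreover have "r = t" if "r > 1 \<and> r - \<phi> r = s" for r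
    using drift_strict_mono[of t r] drift_strict_mono[of r t] that t' assms
    by (cases r t rule: linorder_cases) auto
  ultimately show ?thesis by blast
qed

lemma T_gt_1: "s > 1 - \<phi> 1 \<Longrightarrow> T s > 1"
  and T_eq: "s > 1 - \<phi> 1 \<Longrightarrow> T s - \<phi> (T s) = s"
  using theI'[OF T_ex1] unfolding T_def by auto

lemma dom_1: "s \<ge> 1 \<Longrightarrow> s > 1 - \<phi> 1"
  using pos[of 1] by simp

lemma T_le_iff:
  assumes "s > 1 - \<phi> 1" "t \<ge> 1" shows "T s \<le> t \<longleftrightarrow> s \<le> t - \<phi> t"
proof
  assume "T s \<le> t"
  then show "s \<le> t - \<phi> t"
    using drift_strict_mono[of "T s" t] T_eq[OF assms(1)] T_gt_1[OF assms(1)] assms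
    by (cases "T s = t") auto
next
  assume "s \<le> t - \<phi> t"
  show "T s \<le> t"
  proof (rule ccontr)
    assume "\<not> T s \<le> t"
    then show False
      using drift_strict_mono[of t "T s"] T_eq[OF assms(1)] \<open>s \<le> t - \<phi> t\<close> assms by auto
  qed
qed

lemma le_T_I:
  assumes "s > 1 - \<phi> 1" "t > 1" "t - \<phi> t \<le> s" shows "t \<le> T s"
proof (rule ccontr)
  assume "\<not> t \<le> T s"
  then show False
    using drift_strict_mono[of "T s" t] T_eq[OF assms(1)] T_gt_1[OF assms(1)] assms by auto
qed

lemma T_mono:
  assumes "s > 1 - \<phi> 1" "s \<le> s'" shows "T s \<le> T s'"
  using le_T_I[of s' "T s"] T_eq[of s] T_gt_1[of s] assms by auto

text \<open>The inverse of an increasing convex function is concave. The sign is chosen to match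
  \<open>convex_le_Inf_differential\<close>, which supplies the tangents.\<close>

lemma minus_T_convex: "convex_on {1 - \<phi> 1<..} (\<lambda>s. - T s)"
proof (rule convex_onI)
  fix u x y :: real
  assume u: "0 < u" "u < 1" and x: "x \<in> {1 - \<phi> 1<..}" and y: "y \<in> {1 - \<phi> 1<..}"
  let ?t = "(1 - u) * T x + u * T y"
  let ?s = "(1 - u) * x + u * y"
  have s: "?s > 1 - \<phi> 1"
    using convexD_alt[of "{1 - \<phi> 1<..}" x y u] x y u by (simp add: algebra_simps)
  have t: "?t > 1"
    using convexD_alt[of "{1::real<..}" "T x" "T y" u] T_gt_1[of x] T_gt_1[of y] x y u
    by (simp add: algebra_simps)
  have "?t - \<phi> ?t \<le> (1 - u) * (T x - \<phi> (T x)) + u * (T y - \<phi> (T y))"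
    using concD[of "T x" "T y" u] T_gt_1[of x] T_gt_1[of y] x y u by (simp add: algebra_simps)
  also have "\<dots> = ?s" using T_eq x y by simp
  finally have "?t \<le> T ?s" by (intro le_T_I s t)
  then show "- T ((1 - u) *\<^sub>R x + u *\<^sub>R y) \<le> (1 - u) * - T x + u * - T y" by simp
qed (simp add: convex_real_interval)

lemma T_tangent:
  assumes "c > 1 - \<phi> 1"
  obtains A where "\<And>s. s > 1 - \<phi> 1 \<Longrightarrow> T s \<le> T c + A * (s - c)"
proof -
  have "c \<in> interior {1 - \<phi> 1<..}" using assms by (simp add: interior_open)
  from convex_le_Inf_differential[OF minus_T_convex this] obtain B where
    B: "\<And>s. s > 1 - \<phi> 1 \<Longrightarrow> - T s \<ge> - T c + B * (s - c)" by force
  show ?thesis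
    by (rule that[of "- B"]) (use B in force)
qed

text \<open>Both claims follow by integrating the tangent to \<open>T\<close> at the mean: it bounds
  \<open>T (w y)\<close> by an affine function of \<open>w y\<close>, which is summable.\<close>

lemma T_jensen:
  fixes p w :: "'a \<Rightarrow> real"
  assumes p: "\<And>y. 0 \<le> p y" "(p has_sum 1) UNIV" and w: "\<And>y. w y \<ge> 1"
    and pw: "(\<lambda>y. p y * w y) summable_on UNIV"
  shows "(\<lambda>y. p y * T (w y)) summable_on UNIV"
    and "(\<Sum>\<^sub>\<infinity>y. p y * T (w y)) \<le> T (\<Sum>\<^sub>\<infinity>y. p y * w y)"
proof -
  let ?c = "\<Sum>\<^sub>\<infinity>y. p y * w y"
  have "(\<Sum>\<^sub>\<infinity>y. p y) \<le> ?c"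
  proof (rule infsum_mono[OF has_sum_imp_summable[OF p(2)] pw])
    show "p y \<le> p y * w y" for y
      using mult_left_mono[OF w[of y] p(1)[of y]] by simp
  qed
  then have c: "?c > 1 - \<phi> 1" using p(2) dom_1 by (simp add: infsumI)
  obtain A where A: "\<And>s. s > 1 - \<phi> 1 \<Longrightarrow> T s \<le> T ?c + A * (s - ?c)"
    using T_tangent[OF c] by blast
  have hs: "((\<lambda>y. p y * (T ?c - A * ?c) + A * (p y * w y)) has_sum (1 * (T ?c - A * ?c) + A * ?c)) UNIV"
    by (intro has_sum_add has_sum_cmult_left[OF p(2)] has_sum_cmult_right has_sum_infsum pw)
  have le: "p y * T (w y) \<le> p y * (T ?c - A * ?c) + A * (p y * w y)" for y
    using mult_left_mono[OF A[OF dom_1[OF w[of y]]] p(1)[of y]] by (simp add: algebra_simps)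
  have nn: "0 \<le> p y * T (w y)" for y
    using p(1) T_gt_1[OF dom_1[OF w[of y]]] by simp
  show sm: "(\<lambda>y. p y * T (w y)) summable_on UNIV"
    by (rule summable_on_comparison_test[OF has_sum_imp_summable[OF hs]]) (use le nn in auto)
  show "(\<Sum>\<^sub>\<infinity>y. p y * T (w y)) \<le> T ?c"
    using has_sum_mono[OF has_sum_infsum[OF sm] hs] le by simp
qed

section \<open>Iterates of \<open>T\<close> and the inverse of \<open>H_fun \<phi>\<close>\<close>

lemma T_iter_ge_1: "s \<ge> 1 \<Longrightarrow> (T ^^ k) s \<ge> 1"
  by (induction k) (auto dest: dom_1 T_gt_1 intro: less_imp_le)

lemma T_iter_mono: "1 \<le> s \<Longrightarrow> s \<le> s' \<Longrightarrow> (T ^^ k) s \<le> (T ^^ k) s'"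
  by (induction k) (auto intro!: T_mono dom_1 T_iter_ge_1)

lemma phi_mono: "1 \<le> s \<Longrightarrow> s \<le> t \<Longrightarrow> \<phi> s \<le> \<phi> t"
  using mono by (auto simp: mono_on_def)

text \<open>This is the implicit Euler scheme with unit step for the equation y' = \<phi>(y): the
  slope is taken at the new point.\<close>

lemma T_iter_Suc: "s \<ge> 1 \<Longrightarrow> (T ^^ Suc k) s - (T ^^ k) s = \<phi> ((T ^^ Suc k) s)"
  using T_eq[OF dom_1[OF T_iter_ge_1[of s k]]] by simp

lemma T_iter_incseq:
  assumes "s \<ge> 1" "k \<le> l" shows "(T ^^ k) s \<le> (T ^^ l) s"
proof (rule lift_Suc_mono_le[of "\<lambda>k. (T ^^ k) s", OF _ assms(2)])
  show "(T ^^ k) s \<le> (T ^^ Suc k) s" for k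
    using T_iter_Suc[OF assms(1), of k] pos[OF T_iter_ge_1[OF assms(1), of "Suc k"]] by simp
qed

lemma inverse_phi_integrable: "1 \<le> a \<Longrightarrow> (\<lambda>y. 1 / \<phi> y) integrable_on {a..c}"
  using pos by (intro integrable_continuous_interval continuous_intros continuous_on_subset[OF cont])
    (auto, metis less_irrefl order_trans)

lemma H_increment:
  assumes "1 \<le> a" "a \<le> c" shows "H_fun \<phi> a + (c - a) / \<phi> c \<le> H_fun \<phi> c"
proof -
  have "H_fun \<phi> a + integral {a..c} (\<lambda>y. 1 / \<phi> y) = H_fun \<phi> c"
    unfolding H_fun_def
    using assms inverse_phi_integrable[of 1 c] by (intro Henstock_Kurzweil_Integration.integral_combine) auto
  moreover have "integral {a..c} (\<lambda>y. 1 / \<phi> c) \<le> integral {a..c} (\<lambda>y. 1 / \<phi> y)"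
    using assms pos by (intro integral_le inverse_phi_integrable)
      (auto intro!: divide_left_mono phi_mono mult_pos_pos)
  ultimately show ?thesis using assms by simp
qed

text \<open>Each Euler step has length \<open>\<phi>\<close> at its right end, where
  \<open>1 / \<phi>\<close> is smallest, so it adds at least 1 to
  \<open>H_fun \<phi>\<close>.\<close>

lemma H_T_iter: "real k \<le> H_fun \<phi> ((T ^^ k) 1)"
proof (induction k)
  case 0
  then show ?case by (simp add: H_fun_def)
next
  case (Suc k)
  let ?a = "(T ^^ k) 1" and ?c = "(T ^^ Suc k) 1"
  have "?c - ?a = \<phi> ?c" using T_iter_Suc[of 1 k] by simp
  moreover have "\<phi> ?c > 0" by (rule pos[OF T_iter_ge_1]) simp
  moreover have "?a \<le> ?c" by (rule T_iter_incseq) auto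
  moreover have "1 \<le> ?a" by (rule T_iter_ge_1) simp
  ultimately have "H_fun \<phi> ?a + 1 \<le> H_fun \<phi> ?c"
    using H_increment[of ?a ?c] by simp
  with Suc show ?case by simp
qed

lemma r_fun_bounds:
  assumes "m \<ge> 1" shows "0 < r_fun \<phi> (real m - 1)" and "r_fun \<phi> (real m - 1) \<le> \<phi> ((T ^^ m) 1)"
proof -
  let ?c = "(T ^^ m) 1"
  have c1: "1 \<le> ?c" by (rule T_iter_ge_1) simp
  have "continuous_on {1..?c} (H_fun \<phi>)"
    unfolding H_fun_def by (rule indefinite_integral_continuous_1[OF inverse_phi_integrable]) simp
  \<comment> \<open>\<open>inv_into\<close> is meaningful only on the image of
    \<open>H_fun \<phi>\<close>; the intermediate value theorem places \<open>real m - 1\<close>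
    there.\<close>
  then have "\<exists>x\<ge>1. x \<le> ?c \<and> H_fun \<phi> x = real m - 1"
    using assms c1 H_T_iter[of m] by (intro IVT') (auto simp: H_fun_def)
  then have img: "real m - 1 \<in> H_fun \<phi> ` {1..}" by force
  define h where "h = inv_into {1..} (H_fun \<phi>) (real m - 1)"
  have h1: "1 \<le> h" using inv_into_into[OF img] by (simp add: h_def)
  have hH: "H_fun \<phi> h = real m - 1" using f_inv_into_f[OF img] by (simp add: h_def)
  have r: "r_fun \<phi> (real m - 1) = \<phi> h" using assms by (simp add: r_fun_def h_def)
  show "0 < r_fun \<phi> (real m - 1)" using pos[OF h1] r by simp
  \<comment> \<open>The value at \<open>h\<close> is \<open>m - 1\<close>, that at \<open>?c\<close>
    is at least \<open>m\<close>. This gap makes weak monotonicity of \<open>H_fun \<phi>\<close>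
    sufficient, whichever preimage \<open>h\<close> is.\<close>
  have "h \<le> ?c"
  proof (rule ccontr)
    assume "\<not> h \<le> ?c"
    then have "H_fun \<phi> ?c \<le> H_fun \<phi> h"
      using H_increment[OF c1, of h] divide_nonneg_pos[OF _ pos[OF h1], of "h - ?c"] by linarith
    with hH H_T_iter[of m] show False by simp
  qed
  then show "r_fun \<phi> (real m - 1) \<le> \<phi> ?c" unfolding r by (rule phi_mono[OF h1])
qed

end

section \<open>Drift bounds on the survival probabilities\<close>

context concave_rate
begin

context
  fixes P :: "nat \<times> 'd::finite \<Rightarrow> nat \<times> 'd \<Rightarrow> real" and v :: "nat \<times> 'd \<Rightarrow> real"
  assumes P: "stochastic P" and v: "\<And>x. v x \<ge> 1"
    and Pv: "\<And>x. (\<lambda>y. P x y * v y) summable_on UNIV"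
    and drift: "\<And>x. 0 < fst x \<Longrightarrow> (\<Sum>\<^sub>\<infinity>y. P x y * v y) \<le> v x - \<phi> (v x)"
begin

lemma T_iter_summable: "(\<lambda>y. P x y * (T ^^ k) (v y)) summable_on UNIV"
proof (induction k)
  case (Suc k)
  have "(\<lambda>y. P x y * T ((T ^^ k) (v y))) summable_on UNIV"
    by (rule T_jensen(1)[OF stochastic_nonneg[OF P] stochastic_has_sum[OF P] _ Suc])
       (rule T_iter_ge_1[OF v])
  then show ?case by simp
qed (simp add: Pv)

text \<open>Jensen moves one \<open>T\<close> outside the average. At \<open>k = 0\<close> the drift
  inequality, read through \<open>T_le_iff\<close>, undoes that \<open>T\<close>; afterwards
  monotonicity of \<open>T\<close> carries the bound along.\<close>

lemma T_iter_drift: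
  assumes "0 < fst x"
  shows "(\<Sum>\<^sub>\<infinity>y. P x y * (T ^^ Suc k) (v y)) \<le> (T ^^ k) (v x)"
proof (induction k)
  have jensen: "(\<Sum>\<^sub>\<infinity>y. P x y * (T ^^ Suc k) (v y)) \<le> T (\<Sum>\<^sub>\<infinity>y. P x y * (T ^^ k) (v y))" for k
    using T_jensen(2)[OF stochastic_nonneg[OF P] stochastic_has_sum[OF P] _ T_iter_summable, of k x]
      T_iter_ge_1[OF v] by simp
  have ge1: "(\<Sum>\<^sub>\<infinity>y. P x y * (T ^^ k) (v y)) \<ge> 1" for k
  proof -
    have "infsum (P x) UNIV \<le> (\<Sum>\<^sub>\<infinity>y. P x y * (T ^^ k) (v y))"
    proof (rule infsum_mono[OF stochastic_summable[OF P] T_iter_summable])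
      show "P x y \<le> P x y * (T ^^ k) (v y)" for y
        using mult_left_mono[OF T_iter_ge_1[OF v, of k y] stochastic_nonneg[OF P, of x y]] by simp
    qed
    then show ?thesis by (simp add: stochastic_infsum[OF P])
  qed
  {
    case 0
    have "(\<Sum>\<^sub>\<infinity>y. P x y * (T ^^ Suc 0) (v y)) \<le> T (\<Sum>\<^sub>\<infinity>y. P x y * v y)"
      using jensen[of 0] by simp
    also have "\<dots> \<le> v x"
      using drift[OF assms] ge1[of 0] v by (subst T_le_iff) (auto intro: dom_1)
    finally show ?case by simp
  next
    case (Suc k)
    have "(\<Sum>\<^sub>\<infinity>y. P x y * (T ^^ Suc (Suc k)) (v y)) \<le> T (\<Sum>\<^sub>\<infinity>y. P x y * (T ^^ Suc k) (v y))"
      by (rule jensen)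
    also have "\<dots> \<le> T ((T ^^ k) (v x))"
      by (rule T_mono[OF dom_1[OF ge1] Suc])
    finally show ?case by simp
  }
qed

text \<open>Averages a bound known off level 0 over one step. On level 0 the left integrand vanishes
  and the right one is nonnegative since \<open>v \<ge> 1\<close>. The start \<open>x\<close> is
  arbitrary, so this serves both the induction that follows and starts on level 0.\<close>

lemma survival_sum_step:
  assumes IH: "\<And>y. 0 < fst y \<Longrightarrow>
      (\<Sum>j<N. \<phi> ((T ^^ Suc (k + j)) 1) * survival P j y) \<le> (T ^^ k) (v y) - (T ^^ k) 1"
  shows "(\<Sum>j<N. \<phi> ((T ^^ Suc (k + j)) 1) * survival P (Suc j) x)
      \<le> (\<Sum>\<^sub>\<infinity>y. P x y * (T ^^ k) (v y)) - (T ^^ k) 1"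
proof -
  have hs: "((\<lambda>y. \<Sum>j<N. \<phi> ((T ^^ Suc (k + j)) 1) * (P x y * (of_bool (0 < fst y) * survival P j y)))
      has_sum (\<Sum>j<N. \<phi> ((T ^^ Suc (k + j)) 1) * survival P (Suc j) x)) UNIV"
    unfolding survival.simps
    by (intro has_sum_sum finite_lessThan has_sum_cmult_right has_sum_infsum
          summable_on_mult_bounded[OF stochastic_summable[OF P], of _ 1] survival_bounded_abs[OF P])
  have hs2: "((\<lambda>y. P x y * (T ^^ k) (v y) - P x y * (T ^^ k) 1) has_sum
      ((\<Sum>\<^sub>\<infinity>y. P x y * (T ^^ k) (v y)) - 1 * (T ^^ k) 1)) UNIV"
    by (intro has_sum_diff has_sum_infsum T_iter_summable has_sum_cmult_left stochastic_has_sum[OF P])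
  have "(\<Sum>j<N. \<phi> ((T ^^ Suc (k + j)) 1) * survival P (Suc j) x) \<le>
      (\<Sum>\<^sub>\<infinity>y. P x y * (T ^^ k) (v y)) - 1 * (T ^^ k) 1"
  proof (rule has_sum_mono[OF hs hs2])
    fix y
    have "(\<Sum>j<N. \<phi> ((T ^^ Suc (k + j)) 1) * (P x y * (of_bool (0 < fst y) * survival P j y))) =
        P x y * (of_bool (0 < fst y) * (\<Sum>j<N. \<phi> ((T ^^ Suc (k + j)) 1) * survival P j y))"
      by (simp add: sum_distrib_left mult_ac)
    also have "\<dots> \<le> P x y * ((T ^^ k) (v y) - (T ^^ k) 1)"
      using IH[of y] T_iter_mono[OF order_refl v]
      by (intro mult_left_mono stochastic_nonneg[OF P]) (auto simp: of_bool_def)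
    finally show "(\<Sum>j<N. \<phi> ((T ^^ Suc (k + j)) 1) * (P x y * (of_bool (0 < fst y) * survival P j y)))
        \<le> P x y * (T ^^ k) (v y) - P x y * (T ^^ k) 1"
      by (simp add: right_diff_distrib)
  qed
  then show ?thesis by simp
qed

text \<open>A supermartingale argument with potential \<open>(T ^^ k) (v x) - (T ^^ k) 1\<close> at
  time \<open>k\<close>: by \<open>T_iter_Suc\<close> it falls each step by at least the weight
  charged for survival. The offset \<open>k\<close> is free because the induction shifts time by
  one.\<close>

lemma survival_sum_le:
  assumes "0 < fst x"
  shows "(\<Sum>j<N. \<phi> ((T ^^ Suc (k + j)) 1) * survival P j x) \<le> (T ^^ k) (v x) - (T ^^ k) 1"
  using assms
proof (induction N arbitrary: k x)
  case 0
  then show ?case using T_iter_mono[OF order_refl v] by simp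
next
  case (Suc N)
  have "(\<Sum>j<Suc N. \<phi> ((T ^^ Suc (k + j)) 1) * survival P j x) =
      \<phi> ((T ^^ Suc k) 1) + (\<Sum>j<N. \<phi> ((T ^^ Suc (Suc k + j)) 1) * survival P (Suc j) x)"
    by (subst sum.lessThan_Suc_shift) (simp del: funpow.simps survival.simps(2))
  also have "\<dots> \<le> \<phi> ((T ^^ Suc k) 1) + ((\<Sum>\<^sub>\<infinity>y. P x y * (T ^^ Suc k) (v y)) - (T ^^ Suc k) 1)"
    by (intro add_left_mono survival_sum_step Suc.IH)
  also have "\<dots> \<le> (T ^^ k) (v x) - (T ^^ k) 1"
    using T_iter_drift[OF Suc.prems, of k] T_iter_Suc[of 1 k] by linarith
  finally show ?case .
qed

lemma survival_tendsto_0: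
  assumes "0 < fst x" shows "(\<lambda>j. survival P j x) \<longlonglongrightarrow> 0"
proof (rule summable_LIMSEQ_zero)
  let ?c = "\<phi> 1"
  have c: "?c > 0" by (rule pos) simp
  have "(\<Sum>j<N. survival P j x) \<le> v x / ?c" for N
  proof -
    \<comment> \<open>All weights are at least \<open>\<phi> 1\<close>, so the weighted bound makes
      the survival probabilities summable.\<close>
    have "(\<Sum>j<N. ?c * survival P j x) \<le> (\<Sum>j<N. \<phi> ((T ^^ Suc (0 + j)) 1) * survival P j x)"
      by (intro sum_mono mult_right_mono phi_mono T_iter_ge_1 survival_bounds[OF P]) auto
    also have "\<dots> \<le> v x - 1" using survival_sum_le[OF assms, of 0 N] by simp
    finally show ?thesis using c by (simp add: sum_distrib_left[symmetric] field_simps)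
  qed
  then show "summable (\<lambda>j. survival P j x)"
    using survival_bounds(1)[OF P] by (intro summableI_nonneg_bounded)
qed

text \<open>Telescoping leaves the excursion probabilities from time \<open>m\<close> on plus a
  vanishing remainder. From then on the weights are at least \<open>?c\<close>, so dividing the
  weighted bound by \<open>?c\<close> gives the rate.\<close>

lemma survival_mass_le:
  assumes \<pi>: "stationary_prob P \<pi>" and bm: "block_monotone P" and bi: "block_increasing v"
  shows "(\<Sum>\<^sub>\<infinity>x. \<pi> x * (of_bool (0 < fst x) * survival P m x))
      \<le> phase_avg v 1 (level_tail \<pi> 0) / \<phi> ((T ^^ Suc m) 1)"
proof -
  note \<pi>D = stationary_probD[OF \<pi>]
  define a where "a m = (\<Sum>\<^sub>\<infinity>x. \<pi> x * (of_bool (0 < fst x) * survival P m x))" for m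
  let ?c = "\<phi> ((T ^^ Suc m) 1)"
  have c: "?c > 0" by (rule pos[OF T_iter_ge_1]) simp
  have telescope: "a m = (\<Sum>j\<in>{m..<m + N}. \<Sum>i\<in>UNIV. \<pi> (0, i) * survival P (Suc j) (0, i)) + a (m + N)" for N
  proof (induction N)
    case (Suc N)
    then show ?case
      using survival_mass_step[OF P \<pi>, of "m + N"] by (simp add: a_def del: survival.simps)
  qed simp
  have hit: "?c * (\<Sum>j\<in>{m..<m + N}. survival P (Suc j) (0, i)) \<le> v (1, i)" for i N
  proof -
    have "?c * (\<Sum>j\<in>{m..<m + N}. survival P (Suc j) (0, i)) \<le>
        (\<Sum>j\<in>{m..<m + N}. \<phi> ((T ^^ Suc j) 1) * survival P (Suc j) (0, i))"
      unfolding sum_distrib_left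
      by (intro sum_mono mult_right_mono phi_mono T_iter_ge_1 T_iter_incseq survival_bounds[OF P]) auto
    also have "\<dots> \<le> (\<Sum>j<m + N. \<phi> ((T ^^ Suc j) 1) * survival P (Suc j) (0, i))"
      by (intro sum_mono2 mult_nonneg_nonneg survival_bounds[OF P] less_imp_le[OF pos] T_iter_ge_1) auto
    also have "\<dots> \<le> (\<Sum>\<^sub>\<infinity>y. P (0, i) y * v y) - 1"
      using survival_sum_step[OF survival_sum_le, where N = "m + N" and k = 0 and x = "(0, i)"] by simp
    \<comment> \<open>The drift inequality on level 0 would bring in \<open>b\<close>. Passing to
      level 1 by block monotonicity avoids it, and this is where \<open>v\<close> at level 1 enters
      the final bound.\<close>
    also have "(\<Sum>\<^sub>\<infinity>y. P (0, i) y * v y) \<le> (\<Sum>\<^sub>\<infinity>y. P (1, i) y * v y)"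
    proof (rule block_order_expectation(2))
      show "level_tail (P (0, i)) l j \<le> level_tail (P (1, i)) l j" for l j
        using bm by (simp add: block_monotone_level_tail)
      show "0 \<le> v x" for x using v[of x] by simp
    qed (use P bi Pv in \<open>auto simp: stochastic_nonneg stochastic_summable\<close>)
    also have "\<dots> \<le> v (1, i) - \<phi> (v (1, i))" by (rule drift) simp
    also have "\<dots> \<le> v (1, i)" using pos[OF v, of "(1, i)"] by simp
    finally show ?thesis by simp
  qed
  have \<pi>0: "\<pi> (0, i) \<le> level_tail \<pi> 0 i" for i
    using level_tail_Suc[OF \<pi>D(2), of 0 i] level_tail_nonneg[of \<pi>] \<pi>D(1) by simp
  have bound: "a m \<le> phase_avg v 1 (level_tail \<pi> 0) / ?c + a (m + N)" for N
  proof -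
    have "(\<Sum>j\<in>{m..<m + N}. \<Sum>i\<in>UNIV. \<pi> (0, i) * survival P (Suc j) (0, i)) =
        (\<Sum>i\<in>UNIV. \<pi> (0, i) * (\<Sum>j\<in>{m..<m + N}. survival P (Suc j) (0, i)))"
      unfolding sum_distrib_left by (rule sum.swap)
    also have "\<dots> \<le> (\<Sum>i\<in>UNIV. level_tail \<pi> 0 i * (v (1, i) / ?c))"
      using hit c v \<pi>0 \<pi>D(1) order_trans[OF zero_le_one v] level_tail_nonneg[of \<pi>, OF \<pi>D(1)]
      by (intro sum_mono mult_mono)
         (auto simp: pos_le_divide_eq mult.commute simp del: survival.simps intro!: sum_nonneg survival_bounds[OF P])
    also have "\<dots> = phase_avg v 1 (level_tail \<pi> 0) / ?c"
      by (simp add: phase_avg_def sum_divide_distrib)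
    finally show ?thesis using telescope[of N] by simp
  qed
  have "a \<longlonglongrightarrow> 0"
    unfolding a_def
  proof (rule infsum_dominated_tendsto_0[OF \<pi>D(1,2)])
    show "(\<lambda>n. of_bool (0 < fst x) * survival P n x) \<longlonglongrightarrow> 0" for x
      using survival_tendsto_0[of x] by (cases "0 < fst x") auto
  qed (use survival_bounds[OF P] in \<open>auto simp: of_bool_def\<close>)
  from LIMSEQ_ignore_initial_segment[OF this, of m]
  have "(\<lambda>N. phase_avg v 1 (level_tail \<pi> 0) / ?c + a (m + N)) \<longlonglongrightarrow> phase_avg v 1 (level_tail \<pi> 0) / ?c + 0"
    by (intro tendsto_intros) (simp add: add.commute)
  then have "a m \<le> phase_avg v 1 (level_tail \<pi> 0) / ?c + 0"
    by (rule LIMSEQ_le_const) (use bound in blast)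
  then show ?thesis by (simp add: a_def)
qed

end
end

section \<open>Truncation and stationary laws\<close>

text \<open>The chain \<open>lc_truncation n P\<close> moves one step with \<open>P\<close> and then lumps.\<close>

definition lump :: "nat \<Rightarrow> (nat \<times> 'd \<Rightarrow> real) \<Rightarrow> nat \<times> 'd \<Rightarrow> real" where
  "lump n \<mu> y = (if fst y < n then \<mu> y else if fst y = n then level_tail \<mu> n (snd y) else 0)"

lemma lc_truncation_eq_lump: "lc_truncation n P x = lump n (P x)"
  by (rule ext) (simp add: lc_truncation_def lump_def level_tail_def)

lemma lump_nonneg: "(\<And>x. 0 \<le> \<mu> x) \<Longrightarrow> 0 \<le> lump n \<mu> y"
  by (simp add: lump_def level_tail_nonneg)

lemma lump_summable:
  fixes \<mu> :: "nat \<times> 'd::finite \<Rightarrow> real"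
  shows "lump n \<mu> summable_on UNIV"
proof (rule summable_on_cong_neutral[THEN iffD1])
  show "lump n \<mu> summable_on ({..n} \<times> UNIV)" by (rule summable_on_finite) simp
qed (auto simp: lump_def)

text \<open>Lumping moves mass onto level \<open>n\<close> within its phase, so the tails up to
  \<open>n\<close> survive intact. Through this the truncation inherits block monotonicity, the
  phase matrix and the drift condition.\<close>

lemma level_tail_lump:
  fixes \<mu> :: "nat \<times> 'd::finite \<Rightarrow> real"
  assumes "\<mu> summable_on UNIV"
  shows "level_tail (lump n \<mu>) l j = (if l \<le> n then level_tail \<mu> l j else 0)"
proof -
  have above: "level_tail (lump n \<mu>) l j = 0" if "l > n" for l
    unfolding level_tail_def using that by (intro infsum_0) (auto simp: lump_def)
  have "level_tail (lump n \<mu>) l j = level_tail \<mu> l j" if "l \<le> n"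
    using that
  proof (induction rule: inc_induct)
    case base
    have "lump n \<mu> (n, j) = level_tail \<mu> n j" by (simp add: lump_def)
    then show ?case
      using level_tail_Suc[OF lump_summable, of n \<mu> n j] above[of "Suc n"] by simp
  next
    case (step k)
    have "lump n \<mu> (k, j) = \<mu> (k, j)" using step.hyps by (simp add: lump_def)
    with step.IH show ?case
      using level_tail_Suc[OF lump_summable, of n \<mu> k j] level_tail_Suc[OF assms, of k j] by simp
  qed
  with above show ?thesis by (auto simp: not_le)
qed

text \<open>The two agree below level \<open>n\<close>, and from \<open>n\<close> on both carry the
  same mass.\<close>

lemma lump_distance:
  fixes \<mu> :: "nat \<times> 'd::finite \<Rightarrow> real"
  assumes \<mu>: "\<And>x. 0 \<le> \<mu> x" "\<mu> summable_on UNIV"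
  shows "(\<Sum>\<^sub>\<infinity>y. \<bar>lump n \<mu> y - \<mu> y\<bar>) \<le> 2 * (\<Sum>j\<in>UNIV. level_tail \<mu> n j)"
proof -
  let ?I = "\<lambda>y :: nat \<times> 'd. of_bool (n \<le> fst y) :: real"
  have tot: "(\<Sum>\<^sub>\<infinity>y. \<nu> y * ?I y) = (\<Sum>j\<in>UNIV. level_tail \<nu> n j)"
    and sm: "(\<lambda>y. \<nu> y * ?I y) summable_on UNIV"
    if "\<nu> summable_on UNIV" for \<nu> :: "nat \<times> 'd \<Rightarrow> real"
  proof -
    show sm: "(\<lambda>y. \<nu> y * ?I y) summable_on UNIV"
      by (rule summable_on_mult_bounded[OF that, of _ 1]) auto
    have "(\<Sum>\<^sub>\<infinity>k. \<nu> (k, j) * ?I (k, j)) = level_tail \<nu> n j" for j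
      unfolding level_tail_def by (rule infsum_cong_neutral) auto
    then show "(\<Sum>\<^sub>\<infinity>y. \<nu> y * ?I y) = (\<Sum>j\<in>UNIV. level_tail \<nu> n j)"
      by (simp add: infsum_levels[OF sm])
  qed
  have "(\<Sum>\<^sub>\<infinity>y. \<bar>lump n \<mu> y - \<mu> y\<bar>) \<le> (\<Sum>\<^sub>\<infinity>y. lump n \<mu> y * ?I y + \<mu> y * ?I y)"
  proof (rule infsum_mono)
    show "(\<lambda>y. \<bar>lump n \<mu> y - \<mu> y\<bar>) summable_on UNIV"
      by (rule summable_on_abs[OF summable_on_diff[OF lump_summable \<mu>(2)]])
    show "(\<lambda>y. lump n \<mu> y * ?I y + \<mu> y * ?I y) summable_on UNIV"
      by (rule summable_on_add[OF sm[OF lump_summable] sm[OF \<mu>(2)]])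
    show "\<bar>lump n \<mu> y - \<mu> y\<bar> \<le> lump n \<mu> y * ?I y + \<mu> y * ?I y" for y
      using \<mu>(1)[of y] lump_nonneg[of \<mu> n y, OF \<mu>(1)]
      by (cases "n \<le> fst y") (simp_all add: lump_def)
  qed
  also have "\<dots> = (\<Sum>j\<in>UNIV. level_tail (lump n \<mu>) n j) + (\<Sum>j\<in>UNIV. level_tail \<mu> n j)"
    by (simp add: infsum_add sm lump_summable \<mu>(2) tot)
  also have "\<dots> = 2 * (\<Sum>j\<in>UNIV. level_tail \<mu> n j)"
    by (simp add: level_tail_lump \<mu>(2))
  finally show ?thesis .
qed

lemma push_lc_truncation:
  fixes P :: "nat \<times> 'd::finite \<Rightarrow> nat \<times> 'd \<Rightarrow> real"
  assumes "stochastic P" and "\<mu> summable_on UNIV"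
  shows "push (lc_truncation n P) \<mu> = lump n (push P \<mu>)"
proof
  fix y
  show "push (lc_truncation n P) \<mu> y = lump n (push P \<mu>) y"
    using level_tail_push[OF assms, of n "snd y"]
    by (auto simp: lump_def push_def[of "lc_truncation n P"] lc_truncation_eq_lump push_def[of P \<mu> y])
qed

lemma stochastic_lc_truncation:
  fixes P :: "nat \<times> 'd::finite \<Rightarrow> nat \<times> 'd \<Rightarrow> real"
  assumes P: "stochastic P"
  shows "stochastic (lc_truncation n P)"
proof -
  have "infsum (lump n (P x)) UNIV = 1" for x
    by (simp add: infsum_eq_level_tails lump_summable level_tail_lump stochastic_summable[OF P])
       (simp add: infsum_eq_level_tails[symmetric] stochastic_summable[OF P] stochastic_infsum[OF P])
  then have "(lump n (P x) has_sum 1) UNIV" for x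
    by (simp add: has_sum_iff lump_summable)
  then show ?thesis
    by (simp add: stochastic_def lc_truncation_eq_lump lump_nonneg stochastic_nonneg[OF P])
qed

lemma level_tail_lc_truncation:
  fixes P :: "nat \<times> 'd::finite \<Rightarrow> nat \<times> 'd \<Rightarrow> real"
  assumes "stochastic P"
  shows "level_tail (lc_truncation n P x) l j = (if l \<le> n then level_tail (P x) l j else 0)"
  by (simp only: lc_truncation_eq_lump level_tail_lump[OF stochastic_summable[OF assms]])

lemma block_monotone_lc_truncation:
  fixes P :: "nat \<times> 'd::finite \<Rightarrow> nat \<times> 'd \<Rightarrow> real"
  assumes "stochastic P" "block_monotone P"
  shows "block_monotone (lc_truncation n P)"
  using assms(2) by (simp add: block_monotone_level_tail level_tail_lc_truncation[OF assms(1)])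

lemma phase_matrix_lc_truncation:
  fixes P :: "nat \<times> 'd::finite \<Rightarrow> nat \<times> 'd \<Rightarrow> real"
  assumes "stochastic P"
  shows "phase_matrix (lc_truncation n P) = phase_matrix P"
  using level_tail_lc_truncation[OF assms, of n _ 0]
  by (simp add: phase_matrix_def level_tail_def fun_eq_iff)

text \<open>Each row of the truncation lies below the matching row of \<open>P\<close> in every
  tail, so a block-increasing \<open>v\<close> has a smaller average.\<close>

lemma drift_condition_lc_truncation:
  fixes P :: "nat \<times> 'd::finite \<Rightarrow> nat \<times> 'd \<Rightarrow> real"
  assumes P: "stochastic P" and bi: "block_increasing v" and v: "\<And>x. 0 \<le> v x"
    and drift: "drift_condition P v \<phi> b"
  shows "drift_condition (lc_truncation n P) v \<phi> b"
proof -
  have tail: "level_tail (lc_truncation n P x) l j \<le> level_tail (P x) l j" for x l j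
    by (simp add: level_tail_lc_truncation[OF P] level_tail_nonneg stochastic_nonneg[OF P])
  have Pv: "(\<lambda>y. P x y * v y) summable_on UNIV" for x
    using drift unfolding drift_condition_def by blast
  note Pn = stochastic_lc_truncation[OF P, of n]
  note cmp = block_order_expectation[OF stochastic_nonneg[OF Pn] stochastic_summable[OF Pn]
      stochastic_nonneg[OF P] stochastic_summable[OF P] tail bi v Pv]
  show ?thesis
    unfolding drift_condition_def
  proof (intro allI conjI)
    fix x
    show "(\<lambda>y. lc_truncation n P x y * v y) summable_on UNIV" by (rule cmp(1))
    show "(\<Sum>\<^sub>\<infinity>y. lc_truncation n P x y * v y) \<le> v x - \<phi> (v x) + b * (if fst x = 0 then 1 else 0)"
      using cmp(2)[of x] drift unfolding drift_condition_def by (meson order_trans)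
  qed
qed

section \<open>The distance between the two orbits, and convergence from level 0\<close>

lemma l1_dist_triangle:
  assumes "\<mu> summable_on UNIV" "\<nu> summable_on UNIV" "\<eta> summable_on UNIV"
  shows "l1_dist \<mu> \<eta> \<le> l1_dist \<mu> \<nu> + l1_dist \<nu> \<eta>"
proof -
  note sm = summable_on_abs[OF summable_on_diff]
  have "l1_dist \<mu> \<eta> \<le> (\<Sum>\<^sub>\<infinity>x. \<bar>\<mu> x - \<nu> x\<bar> + \<bar>\<nu> x - \<eta> x\<bar>)"
    unfolding l1_dist_def
    by (intro infsum_mono summable_on_add sm assms) simp
  also have "\<dots> = l1_dist \<mu> \<nu> + l1_dist \<nu> \<eta>"
    unfolding l1_dist_def by (intro infsum_add sm assms)
  finally show ?thesis .
qed

lemma l1_dist_commute: "l1_dist \<mu> \<nu> = l1_dist \<nu> \<mu>"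
  by (simp add: l1_dist_def abs_minus_commute)

text \<open>One step of each chain from the same law costs a lumping error, and the distance
  accumulated before contracts under \<open>P\<close>.\<close>

lemma truncated_orbit_distance:
  fixes P :: "nat \<times> 'd::finite \<Rightarrow> nat \<times> 'd \<Rightarrow> real"
  assumes P: "stochastic P" and \<mu>: "\<And>x. 0 \<le> \<mu> x" "\<mu> summable_on UNIV"
    and \<epsilon>: "\<And>k. (\<Sum>j\<in>UNIV. level_tail ((push (lc_truncation n P) ^^ k) \<mu>) n j) \<le> \<epsilon>"
  shows "l1_dist ((push (lc_truncation n P) ^^ m) \<mu>) ((push P ^^ m) \<mu>) \<le> 2 * real m * \<epsilon>"
proof (induction m)
  case (Suc m)
  let ?Q = "lc_truncation n P"
  let ?\<mu> = "(push ?Q ^^ m) \<mu>" and ?\<nu> = "(push P ^^ m) \<mu>"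
  note Q = stochastic_lc_truncation[OF P, of n]
  have nn: "0 \<le> ?\<mu> x" for x by (rule push_funpow_nonneg[OF Q \<mu>(1)])
  have sm: "?\<mu> summable_on UNIV" "?\<nu> summable_on UNIV"
    by (rule push_funpow_summable[OF Q \<mu>(2)], rule push_funpow_summable[OF P \<mu>(2)])
  have pnn: "0 \<le> push P ?\<mu> x" for x by (rule push_nonneg[OF P nn])
  have "l1_dist (push ?Q ?\<mu>) (push P ?\<mu>) \<le> 2 * (\<Sum>j\<in>UNIV. level_tail (push P ?\<mu>) n j)"
    unfolding l1_dist_def push_lc_truncation[OF P sm(1)]
    by (rule lump_distance[OF pnn push_summable[OF P sm(1)]])
  \<comment> \<open>Lumping preserves the tail at \<open>n\<close>, so the error is read off the
    truncated orbit itself, which is what \<open>\<epsilon>\<close> controls.\<close>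
  also have "(\<Sum>j\<in>UNIV. level_tail (push P ?\<mu>) n j) = (\<Sum>j\<in>UNIV. level_tail ((push ?Q ^^ Suc m) \<mu>) n j)"
    by (simp add: push_lc_truncation[OF P sm(1)] level_tail_lump[OF push_summable[OF P sm(1)]])
  also have "\<dots> \<le> \<epsilon>" by (rule \<epsilon>)
  finally have 1: "l1_dist (push ?Q ?\<mu>) (push P ?\<mu>) \<le> 2 * \<epsilon>" by simp
  have "l1_dist (push P ?\<mu>) (push P ?\<nu>) \<le> l1_dist ?\<mu> ?\<nu>"
    using push_l1_le[OF P summable_on_diff[OF sm]]
    by (simp add: l1_dist_def push_diff[OF P sm])
  with 1 Suc l1_dist_triangle[OF push_summable[OF Q sm(1)] push_summable[OF P sm(1)] push_summable[OF P sm(2)]]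
  show ?case by (simp add: algebra_simps)
qed (simp add: l1_dist_def)

definition level_0_prob :: "('d \<Rightarrow> real) \<Rightarrow> nat \<times> 'd \<Rightarrow> real" where
  "level_0_prob w x = (if fst x = 0 then w (snd x) else 0)"

lemma level_0_prob_summable:
  fixes w :: "'d::finite \<Rightarrow> real"
  shows "level_0_prob w summable_on UNIV"
proof (rule summable_on_cong_neutral[THEN iffD1])
  show "level_0_prob w summable_on ({0} \<times> UNIV)" by (rule summable_on_finite) simp
qed (auto simp: level_0_prob_def)

text \<open>With all mass on the bottom level, this is the least law for its phase marginal.\<close>

lemma block_le_level_0_prob:
  fixes \<mu> :: "nat \<times> 'd::finite \<Rightarrow> real"
  assumes "\<And>x. 0 \<le> \<mu> x" and "level_tail \<mu> 0 = w"
  shows "block_le (level_0_prob w) \<mu>"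
proof -
  have above: "level_tail (level_0_prob w) (Suc l) j = 0" for l j
    unfolding level_tail_def by (rule infsum_0) (auto simp: level_0_prob_def)
  have "level_tail (level_0_prob w) 0 j = w j" for j
    using level_tail_Suc[OF level_0_prob_summable, of w 0 j] above by (simp add: level_0_prob_def)
  moreover have "level_tail (level_0_prob w) l j \<le> level_tail \<mu> l j" for l j
    using calculation above assms(2) level_tail_nonneg[of \<mu>, OF assms(1)] by (cases l) auto
  ultimately show ?thesis using assms(2) by (simp add: block_le_def)
qed

text \<open>The form is general enough to serve both \<open>P\<close> and its truncation, each with
  its own stationary law.\<close>

lemma (in concave_rate) level_0_convergence:
  fixes P :: "nat \<times> 'd::finite \<Rightarrow> nat \<times> 'd \<Rightarrow> real" and v :: "nat \<times> 'd \<Rightarrow> real"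
  assumes P: "stochastic P" and bm: "block_monotone P" and \<pi>: "stationary_prob P \<pi>"
    and v: "\<And>x. v x \<ge> 1" and bi: "block_increasing v" and drift: "drift_condition P v \<phi> b"
    and w: "level_tail \<pi> 0 = w" and m: "m \<ge> 1"
  shows "l1_dist ((push P ^^ m) (level_0_prob w)) \<pi> \<le> 2 * (phase_avg v 1 w / r_fun \<phi> (real m - 1))"
proof -
  note \<pi>D = stationary_probD[OF \<pi>]
  have Pv: "(\<lambda>y. P x y * v y) summable_on UNIV" for x
    using drift unfolding drift_condition_def by blast
  have d: "(\<Sum>\<^sub>\<infinity>y. P x y * v y) \<le> v x - \<phi> (v x)" if "0 < fst x" for x
  proof -
    have "(\<Sum>\<^sub>\<infinity>y. P x y * v y) \<le> v x - \<phi> (v x) + b * (if fst x = 0 then 1 else 0)"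
      using drift unfolding drift_condition_def by blast
    then show ?thesis using that by simp
  qed
  have wn: "0 \<le> w j" for j using w level_tail_nonneg[of \<pi> 0 j, OF \<pi>D(1)] by simp
  have V: "0 \<le> phase_avg v 1 w"
    unfolding phase_avg_def by (intro sum_nonneg mult_nonneg_nonneg wn order_trans[OF zero_le_one v])
  have "l1_dist ((push P ^^ m) (level_0_prob w)) \<pi> =
      (\<Sum>\<^sub>\<infinity>x. \<bar>(push P ^^ m) (\<lambda>x. level_0_prob w x - \<pi> x) x\<bar>)"
    unfolding l1_dist_def push_funpow_diff[OF P level_0_prob_summable \<pi>D(2)] \<pi>D(5) ..
  also have "\<dots> \<le> 2 * (\<Sum>\<^sub>\<infinity>x. \<pi> x * (of_bool (0 < fst x) * survival P m x))"
    using wn by (intro push_difference_bound[OF P bm _ level_0_prob_summable \<pi>D(1,2)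
          block_le_level_0_prob[OF \<pi>D(1) w]]) (simp add: level_0_prob_def)
  also have "\<dots> \<le> 2 * (phase_avg v 1 w / \<phi> ((T ^^ Suc m) 1))"
    using survival_mass_le[OF P v Pv d \<pi> bm bi, of m] unfolding w by simp
  \<comment> \<open>One Euler step is given away here, from \<open>Suc m\<close> to
    \<open>m\<close>, before comparing with \<open>r_fun\<close>.\<close>
  also have "\<dots> \<le> 2 * (phase_avg v 1 w / r_fun \<phi> (real m - 1))"
  proof -
    have "r_fun \<phi> (real m - 1) \<le> \<phi> ((T ^^ m) 1)" by (rule r_fun_bounds(2)[OF m])
    also have "\<dots> \<le> \<phi> ((T ^^ Suc m) 1)"
      by (intro phi_mono T_iter_ge_1 T_iter_incseq) auto
    finally show ?thesis
      using r_fun_bounds(1)[OF m] V by (intro mult_left_mono divide_left_mono) auto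
  qed
  finally show ?thesis .
qed

section \<open>Uniqueness of the stationary phase law\<close>

text \<open>The support of an invariant \<open>z\<close> is closed under
  \<open>phase_matrix P\<close>. Since \<open>P x y\<close> is at most the corresponding phase
  entry, the chain \<open>P\<close> cannot leave these phases either, contrary to its
  irreducibility.\<close>

lemma irreducible_null_invariant:
  fixes P :: "nat \<times> 'd::finite \<Rightarrow> nat \<times> 'd \<Rightarrow> real"
  assumes P: "stochastic P" and irr: "irreducible_matrix P" and bm: "block_monotone P"
    and z: "\<And>i. 0 \<le> z i" and inv: "\<And>j. (\<Sum>i\<in>UNIV. z i * phase_matrix P i j) = z j"
    and z0: "z i0 = 0"
  shows "z j = 0"
proof (rule ccontr)
  assume nz: "z j \<noteq> 0"
  have row: "P x y \<le> phase_matrix P (snd x) (snd y)" for x y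
  proof -
    have "P x y = (\<Sum>k\<in>{fst y}. P x (k, snd y))" by simp
    also have "\<dots> \<le> (\<Sum>\<^sub>\<infinity>k. P x (k, snd y))"
      by (rule finite_sum_le_infsum)
         (auto intro: summable_on_levels[OF stochastic_summable[OF P]] stochastic_nonneg[OF P])
    also have "\<dots> = phase_matrix P (snd x) (snd y)"
      using block_monotone_phase_const[OF P bm, of "fst x" "snd x" "snd y"]
      by (simp add: level_tail_def)
    finally show ?thesis .
  qed
  have closed: "P x y = 0" if "z (snd x) \<noteq> 0" "z (snd y) = 0" for x y
  proof -
    have \<Psi>: "0 \<le> phase_matrix P i j" for i j
      unfolding phase_matrix_def by (auto intro: infsum_nonneg stochastic_nonneg[OF P])
    have "z (snd x) * phase_matrix P (snd x) (snd y) \<le> (\<Sum>i\<in>UNIV. z i * phase_matrix P i (snd y))"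
      by (rule member_le_sum) (auto intro: z \<Psi> mult_nonneg_nonneg)
    also have "\<dots> = 0" using inv that(2) by simp
    finally have "phase_matrix P (snd x) (snd y) \<le> 0"
      using that(1) z[of "snd x"] by (auto simp: mult_le_0_iff)
    with row[of x y] stochastic_nonneg[OF P, of x y] show ?thesis by simp
  qed
  have "matrix_power P n x y = 0" if "z (snd x) \<noteq> 0" "z (snd y) = 0" for n x y
    using that
  proof (induction n arbitrary: x)
    case (Suc n)
    have "P x u * matrix_power P n u y = 0" for u
      using Suc closed[of x u] by (cases "z (snd u) = 0") auto
    then show ?case unfolding matrix_power.simps by (rule infsum_0)
  qed auto
  from this[of "(0, j)" "(0, i0)"] nz z0 irr show False
    unfolding irreducible_matrix_def by (metis less_irrefl snd_conv)
qed

text \<open>For the difference \<open>d\<close> of two solutions, \<open>\<bar>d\<bar>\<close> is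
  invariant too, as the triangle inequality holds entrywise with equal totals. So twice the positive
  part of \<open>d\<close> is invariant; it vanishes somewhere because \<open>d\<close> sums to 0,
  hence everywhere.\<close>

lemma phase_stationary_unique:
  fixes P :: "nat \<times> 'd::finite \<Rightarrow> nat \<times> 'd \<Rightarrow> real"
  assumes P: "stochastic P" and irr: "irreducible_matrix P" and bm: "block_monotone P"
    and w: "\<And>j. (\<Sum>i\<in>UNIV. w i * phase_matrix P i j) = w j" "sum w UNIV = 1"
    and w': "\<And>j. (\<Sum>i\<in>UNIV. w' i * phase_matrix P i j) = w' j" "sum w' UNIV = 1"
  shows "w = w'"
proof -
  define d where "d i = w i - w' i" for i
  have d: "(\<Sum>i\<in>UNIV. d i * phase_matrix P i j) = d j" for j
    by (simp add: d_def left_diff_distrib sum_subtractf w w')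
  have d0: "sum d UNIV = 0" by (simp add: d_def sum_subtractf w w')
  have \<Psi>: "0 \<le> phase_matrix P i j" for i j
    unfolding phase_matrix_def by (auto intro: infsum_nonneg stochastic_nonneg[OF P])
  have \<Psi>1: "(\<Sum>j\<in>UNIV. phase_matrix P i j) = 1" for i
    using infsum_eq_level_tails[OF stochastic_summable[OF P], of "(0, i)"]
    by (simp add: stochastic_infsum[OF P] block_monotone_phase_const[OF P bm])
  have le: "\<bar>d j\<bar> \<le> (\<Sum>i\<in>UNIV. \<bar>d i\<bar> * phase_matrix P i j)" for j
    using sum_abs[of "\<lambda>i. d i * phase_matrix P i j" UNIV] by (simp add: d abs_mult \<Psi>)
  have "(\<Sum>j\<in>UNIV. \<Sum>i\<in>UNIV. \<bar>d i\<bar> * phase_matrix P i j) = (\<Sum>i\<in>UNIV. \<bar>d i\<bar>)"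
    by (subst sum.swap) (simp add: sum_distrib_left[symmetric] \<Psi>1)
  then have abs: "\<bar>d j\<bar> = (\<Sum>i\<in>UNIV. \<bar>d i\<bar> * phase_matrix P i j)" for j
    by (rule sum_mono_inv[OF sym le UNIV_I finite])
  define z where "z i = \<bar>d i\<bar> + d i" for i
  have z: "0 \<le> z i" "(\<Sum>i\<in>UNIV. z i * phase_matrix P i j) = z j" for i j
    by (simp_all add: z_def distrib_right sum.distrib abs[symmetric] d)
  have "\<exists>i. z i = 0"
  proof (rule ccontr)
    assume "\<nexists>i. z i = 0"
    then have "z i \<noteq> 0" for i by blast
    then have "0 < d i" for i using z_def[of i] by (smt (verit))
    then have "0 < sum d UNIV" by (intro sum_pos) auto
    with d0 show False by simp
  qed
  then obtain i0 where "z i0 = 0" ..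
  then have "z j = 0" for j by (rule irreducible_null_invariant[OF P irr bm z])
  then have "d j \<le> 0" for j unfolding z_def by (smt (verit))
  then have "d j = 0" for j
    using sum_nonneg_eq_0_iff[of UNIV "\<lambda>j. - d j"] d0 by (simp add: sum_negf)
  then show ?thesis by (auto simp: d_def)
qed

lemma stationary_phase_marginal:
  fixes P :: "nat \<times> 'd::finite \<Rightarrow> nat \<times> 'd \<Rightarrow> real"
  assumes P: "stochastic P" and bm: "block_monotone P" and \<pi>: "stationary_prob P \<pi>"
  shows "(\<Sum>i\<in>UNIV. level_tail \<pi> 0 i * phase_matrix P i j) = level_tail \<pi> 0 j"
    and "(\<Sum>i\<in>UNIV. level_tail \<pi> 0 i) = 1"
  using level_tail_push_0[OF P bm stationary_probD(2)[OF \<pi>], of j]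
    infsum_eq_level_tails[OF stationary_probD(2)[OF \<pi>]]
  by (simp_all add: stationary_probD[OF \<pi>])

lemma stationary_lc_truncation_above:
  fixes P :: "nat \<times> 'd::finite \<Rightarrow> nat \<times> 'd \<Rightarrow> real"
  assumes P: "stochastic P" and \<pi>: "stationary_prob (lc_truncation n P) \<pi>" and "n < fst x"
  shows "\<pi> x = 0"
proof -
  have "\<pi> x = push (lc_truncation n P) \<pi> x" by (simp add: stationary_probD[OF \<pi>])
  also have "\<dots> = 0"
    using assms(3) by (simp add: push_lc_truncation[OF P stationary_probD(2)[OF \<pi>]] lump_def)
  finally show ?thesis .
qed

text \<open>Integrate the drift inequality against \<open>\<pi>\<close>. The truncation lives on
  finitely many states, so the two integrals of \<open>v\<close> are finite and cancel, leaving
  \<open>b\<close> as a bound for the integral of \<open>\<phi> (v u)\<close>, of which a single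
  term is kept.\<close>

lemma stationary_lc_truncation_drift:
  fixes P :: "nat \<times> 'd::finite \<Rightarrow> nat \<times> 'd \<Rightarrow> real"
  assumes P: "stochastic P" and \<pi>: "stationary_prob (lc_truncation n P) \<pi>"
    and drift: "drift_condition (lc_truncation n P) v \<phi> b"
    and b: "b > 0" and \<phi>v: "\<And>x. 0 < \<phi> (v x)"
  shows "\<pi> x * \<phi> (v x) \<le> b"
proof (cases "n < fst x")
  case True
  then show ?thesis using stationary_lc_truncation_above[OF P \<pi>] b by simp
next
  case False
  let ?Q = "lc_truncation n P"
  define F where "F = {..n} \<times> (UNIV :: 'd set)"
  have F: "finite F" "x \<in> F" using False by (auto simp: F_def intro!: mem_Times_iff[THEN iffD2])
  note \<pi>D = stationary_probD[OF \<pi>]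
  have row: "(\<Sum>\<^sub>\<infinity>y. ?Q u y * v y) = (\<Sum>y\<in>F. ?Q u y * v y)" for u
  proof -
    have "(\<Sum>\<^sub>\<infinity>y. ?Q u y * v y) = infsum (\<lambda>y. ?Q u y * v y) F"
      by (rule infsum_cong_neutral) (auto simp: F_def lc_truncation_def)
    then show ?thesis using F by simp
  qed
  have out: "\<pi> u = 0" if "u \<notin> F" for u
    using that by (intro stationary_lc_truncation_above[OF P \<pi>]) (cases u, auto simp: F_def)
  have inv: "(\<Sum>u\<in>F. \<pi> u * ?Q u y) = \<pi> y" for y
  proof -
    have "push ?Q \<pi> y = infsum (\<lambda>u. \<pi> u * ?Q u y) F"
      unfolding push_def
      by (rule infsum_cong_neutral) (auto simp: out)
    then show ?thesis using F by (simp add: \<pi>D(4))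
  qed
  have "(\<Sum>u\<in>F. \<pi> u) \<le> infsum \<pi> UNIV"
    by (rule finite_sum_le_infsum[OF \<pi>D(2) F(1)]) (auto intro: \<pi>D(1))
  then have mass: "(\<Sum>u\<in>F. \<pi> u) \<le> 1" by (simp add: \<pi>D(3))
  have "(\<Sum>u\<in>F. \<pi> u * (\<Sum>y\<in>F. ?Q u y * v y)) = (\<Sum>y\<in>F. (\<Sum>u\<in>F. \<pi> u * ?Q u y) * v y)"
    by (simp add: sum_distrib_left sum_distrib_right mult.assoc) (rule sum.swap)
  then have eq: "(\<Sum>u\<in>F. \<pi> u * (\<Sum>y\<in>F. ?Q u y * v y)) = (\<Sum>y\<in>F. \<pi> y * v y)"
    by (simp add: inv)
  have "(\<Sum>u\<in>F. \<pi> u * (\<Sum>y\<in>F. ?Q u y * v y)) \<le> (\<Sum>u\<in>F. \<pi> u * (v u - \<phi> (v u) + b))"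
  proof (intro sum_mono mult_left_mono \<pi>D(1))
    fix u
    have "(\<Sum>y\<in>F. ?Q u y * v y) \<le> v u - \<phi> (v u) + b * (if fst u = 0 then 1 else 0)"
      using drift unfolding drift_condition_def row by blast
    then show "(\<Sum>y\<in>F. ?Q u y * v y) \<le> v u - \<phi> (v u) + b"
      using b by (auto split: if_splits)
  qed
  also have "\<dots> = (\<Sum>u\<in>F. \<pi> u * v u) - (\<Sum>u\<in>F. \<pi> u * \<phi> (v u)) + b * (\<Sum>u\<in>F. \<pi> u)"
    by (simp add: algebra_simps sum.distrib sum_subtractf sum_distrib_left)
  finally have "(\<Sum>u\<in>F. \<pi> u * \<phi> (v u)) \<le> b * (\<Sum>u\<in>F. \<pi> u)" using eq by simp
  also have "\<dots> \<le> b" using mass b by simp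
  finally have "(\<Sum>u\<in>F. \<pi> u * \<phi> (v u)) \<le> b" .
  moreover have "\<pi> x * \<phi> (v x) \<le> (\<Sum>u\<in>F. \<pi> u * \<phi> (v u))"
    by (rule member_le_sum[OF F(2) _ F(1)]) (auto intro!: mult_nonneg_nonneg \<pi>D(1) less_imp_le[OF \<phi>v])
  ultimately show ?thesis by linarith
qed

theorem theorem3p1:
  fixes P :: "nat \<times> 'd::finite \<Rightarrow> nat \<times> 'd \<Rightarrow> real"
    and \<pi> \<pi>n v :: "nat \<times> 'd \<Rightarrow> real"
    and \<omega> :: "'d \<Rightarrow> real"
    and \<phi> :: "real \<Rightarrow> real"
    and b :: real
    and n m :: nat
  assumes "stochastic P"
    and "irreducible_matrix P"
    and "positive_recurrent P"
    and "block_monotone P"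
    and "stationary_prob P \<pi>"
    and "stationary_prob (phase_matrix P) \<omega>"
    and "b > 0"
    and "block_increasing v"
    and "\<And>x. v x \<ge> 1"
    and "\<And>t. t \<ge> 1 \<Longrightarrow> \<phi> t > 0"
    and "mono_on {1..} \<phi>"
    and "\<phi> differentiable_on {1..}"
    and "concave_on {1..} \<phi>"
    and "(deriv \<phi> \<longlongrightarrow> 0) at_top"
    and "drift_condition P v \<phi> b"
    and "n \<ge> 1"
    and "m \<ge> 1"
    and "stationary_prob (lc_truncation n P) \<pi>n"
  shows "l1_dist \<pi>n \<pi> \<le> 8 / r_fun \<phi> (real m - 1) * phase_avg v 1 \<omega>
           + 2 * real m * (\<Sum>i\<in>UNIV. \<pi>n (n, i))
     \<and> l1_dist \<pi>n \<pi> \<le> 8 / r_fun \<phi> (real m - 1) * phase_avg v 1 \<omega>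
           + 2 * real m * b * (\<Sum>i\<in>UNIV. 1 / \<phi> (v (n, i)))"
proof -
  note P = assms(1) and irr = assms(2) and bm = assms(4) and \<pi> = assms(5) and \<omega> = assms(6)
    and b = assms(7) and bi = assms(8) and v = assms(9) and drift = assms(15) and m = assms(17)
    and \<pi>n = assms(18)
  interpret concave_rate \<phi>
    by unfold_locales (fact assms)+
  let ?Q = "lc_truncation n P"
  note Q = stochastic_lc_truncation[OF P, of n] and Qbm = block_monotone_lc_truncation[OF P bm, of n]
  note \<pi>D = stationary_probD[OF \<pi>] and \<pi>nD = stationary_probD[OF \<pi>n]
  have v0: "0 \<le> v x" for x using v[of x] by simp
  note Qdrift = drift_condition_lc_truncation[OF P bi v0 drift, of n]

  have hs: "((\<lambda>i. \<omega> i * phase_matrix P i j) has_sum \<omega> j) UNIV" "(\<omega> has_sum 1) UNIV" for j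
    using \<omega> unfolding stationary_prob_def by blast+
  have \<omega>inv: "(\<Sum>i\<in>UNIV. \<omega> i * phase_matrix P i j) = \<omega> j" for j
    by (rule has_sum_unique[OF has_sum_finite[OF finite] hs(1)])
  have \<omega>1: "sum \<omega> UNIV = 1"
    by (rule has_sum_unique[OF has_sum_finite[OF finite] hs(2)])
  \<comment> \<open>Both stationary laws have phase marginal \<open>\<omega>\<close>, so the same
    initial law on level 0 lies below each of them.\<close>
  have w: "level_tail \<pi> 0 = \<omega>"
    by (rule phase_stationary_unique[OF P irr bm stationary_phase_marginal[OF P bm \<pi>] \<omega>inv \<omega>1])
  have wn: "level_tail \<pi>n 0 = \<omega>"
    by (rule phase_stationary_unique[OF P irr bm
          stationary_phase_marginal[OF Q Qbm \<pi>n, unfolded phase_matrix_lc_truncation[OF P]] \<omega>inv \<omega>1])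
  have \<omega>0: "0 \<le> \<omega> i" for i using \<omega> unfolding stationary_prob_def by blast

  define \<delta> where "\<delta> = level_0_prob \<omega>"
  have \<delta>: "0 \<le> \<delta> x" "\<delta> summable_on UNIV" for x
    using \<omega>0 by (simp_all add: \<delta>_def level_0_prob_summable) (simp add: level_0_prob_def)
  define \<epsilon> where "\<epsilon> = (\<Sum>i\<in>UNIV. \<pi>n (n, i))"
  define R where "R = phase_avg v 1 \<omega> / r_fun \<phi> (real m - 1)"

  \<comment> \<open>The order holds at time 0 and is preserved, while \<open>\<pi>n\<close> is a
    fixed point; so the mass of the orbit on level \<open>n\<close> never exceeds that of
    \<open>\<pi>n\<close>.\<close>
  have dom: "block_le ((push ?Q ^^ k) \<delta>) \<pi>n" for k
  proof (induction k)
    case 0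
    show ?case unfolding \<delta>_def using block_le_level_0_prob[OF \<pi>nD(1) wn] by simp
  next
    case (Suc k)
    from block_le_push[OF Q Qbm push_funpow_nonneg[OF Q \<delta>(1)] push_funpow_summable[OF Q \<delta>(2)] \<pi>nD(1,2) this]
    show ?case by (simp add: \<pi>nD(4))
  qed
  have top: "level_tail \<pi>n n j = \<pi>n (n, j)" for j
  proof -
    have "level_tail \<pi>n (Suc n) j = 0"
      unfolding level_tail_def
      by (rule infsum_0) (auto intro: stationary_lc_truncation_above[OF P \<pi>n])
    then show ?thesis using level_tail_Suc[OF \<pi>nD(2), of n j] by simp
  qed
  have "(\<Sum>j\<in>UNIV. level_tail ((push ?Q ^^ k) \<delta>) n j) \<le> \<epsilon>" for k
    unfolding \<epsilon>_def top[symmetric] using dom[of k] by (intro sum_mono) (simp add: block_le_def)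
  from truncated_orbit_distance[OF P \<delta> this]
  have mid: "l1_dist ((push ?Q ^^ m) \<delta>) ((push P ^^ m) \<delta>) \<le> 2 * real m * \<epsilon>" .
  have conv: "l1_dist ((push P ^^ m) \<delta>) \<pi> \<le> 2 * R"
    unfolding R_def \<delta>_def by (rule level_0_convergence[OF P bm \<pi> v bi drift w m])
  have convn: "l1_dist ((push ?Q ^^ m) \<delta>) \<pi>n \<le> 2 * R"
    unfolding R_def \<delta>_def by (rule level_0_convergence[OF Q Qbm \<pi>n v bi Qdrift wn m])
  have "0 \<le> phase_avg v 1 \<omega>"
    unfolding phase_avg_def by (intro sum_nonneg mult_nonneg_nonneg \<omega>0 v0)
  then have "0 \<le> R" using r_fun_bounds(1)[OF m] by (simp add: R_def)
  have "l1_dist \<pi>n \<pi> \<le> l1_dist \<pi>n ((push ?Q ^^ m) \<delta>) +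
      (l1_dist ((push ?Q ^^ m) \<delta>) ((push P ^^ m) \<delta>) + l1_dist ((push P ^^ m) \<delta>) \<pi>)"
    using l1_dist_triangle[OF \<pi>nD(2) push_funpow_summable[OF Q \<delta>(2), of m] \<pi>D(2)]
      l1_dist_triangle[OF push_funpow_summable[OF Q \<delta>(2), of m] push_funpow_summable[OF P \<delta>(2), of m] \<pi>D(2)]
    by linarith
  \<comment> \<open>The three distances add up to \<open>4 * R\<close> plus the middle term; since
    \<open>R\<close> is nonnegative, this is relaxed to the stated constant 8.\<close>
  also have "\<dots> \<le> 8 * R + 2 * real m * \<epsilon>"
    using mid conv convn \<open>0 \<le> R\<close> by (simp add: l1_dist_commute[of \<pi>n])
  finally have first: "l1_dist \<pi>n \<pi> \<le> 8 / r_fun \<phi> (real m - 1) * phase_avg v 1 \<omega> + 2 * real m * \<epsilon>"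
    by (simp add: R_def)
  have \<phi>v: "0 < \<phi> (v x)" for x by (rule pos[OF v])
  have "\<epsilon> \<le> (\<Sum>i\<in>UNIV. b * (1 / \<phi> (v (n, i))))"
    unfolding \<epsilon>_def
    using stationary_lc_truncation_drift[OF P \<pi>n Qdrift b \<phi>v] \<phi>v
    by (intro sum_mono) (simp add: pos_le_divide_eq)
  also have "\<dots> = b * (\<Sum>i\<in>UNIV. 1 / \<phi> (v (n, i)))" by (simp add: sum_distrib_left)
  finally have "2 * real m * \<epsilon> \<le> 2 * real m * (b * (\<Sum>i\<in>UNIV. 1 / \<phi> (v (n, i))))"
    by (intro mult_left_mono) auto
  with first show ?thesis by (simp add: \<epsilon>_def mult.assoc)
qed

end
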